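(* Suppose that $\emptyset\in\Psi$ and let $\alpha,\beta,\gamma,\delta\in(0,1)$. For each $e\in\mathcal K$ set $a_e:=|\mathcal H_{\Psi,e}^{s'_e}|$, $b_e:=|\mathcal G_{\Psi,e}^{s'_e}|$, $c_e:=|\mathcal H_0^{s_e}|$, $d_e:=|\mathcal G_{\Psi,e}^{s_e}|$. (i) $\chi^*_{det}\in\mathcal D_\Psi(\alpha,\beta)$ when $C_e\ge c_e/\beta$ and $D_e\ge d_e|\mathcal K|/\alpha$ for all $e\in\mathcal K$. (ii) $\chi^*_{fwer}\in\mathcal E_\Psi(\gamma,\delta)$ when $A_e\ge(a_e\vee c_e)(|\mathcal K|+1)/\delta$ and $B_e\ge(b_e\vee d_e)|\mathcal K|/\gamma$ for all $e\in\mathcal K$. If, also, $s_e=s'_e=e$ for every $e\in\mathcal K$, then $\chi^*_{fwer}\in\mathcal E_\Psi(\gamma,\delta)$ when $A_e\ge a_e|\mathcal K|/\delta$ and $B_e\ge b_e|\mathcal K|/\gamma$ for all $e\in\mathcal K$. (iii) $\chi^*\in\mathcal C_\Psi(\alpha,\beta,\gamma,\delta)$ when, for all $e\in\mathcal K$, $C_e\ge c_e/\beta$, $D_e\ge d_e|\mathcal K|/\alpha$, $A_e\ge a_e|\mathcal K|/\delta$, $B_e\ge b_e|\mathcal K|/\gamma$.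
   Context: Setting. There are $K$ data sources, $[K]=\{1,\dots,K\}$; $X_n^k$ is the random element observed from source $k$ at time $n\in\mathbb N=\{1,2,\dots\}$. For $s\subseteq[K]$: $X_n^s=\{X_n^k:k\in s\}$, $X^s=\{X_n^s:n\in\mathbb N\}$, $\mathcal F_n^s=\sigma(X_1^s,\dots,X_n^s)$; the superscript is omitted when $s=[K]$. $\mathcal P$ is a finite family of distributions of $X$; $\mathsf P^s$ is the law of $X^s$ under $\mathsf P$, and $\mathcal Q^s=\{\mathsf P^s:\mathsf P\in\mathcal Q\}$ for $\mathcal Q\subseteq\mathcal P$. $\mathcal K$ is a finite family of subsets of $[K]$ (units). For each $e\in\mathcal K$, $\mathcal H^e$ (null) and $\mathcal G^e$ (alternative) are nonempty disjoint subfamilies of $\mathcal P^e$; $\mathcal A(\mathsf P)=\{e\in\mathcal K:\mathsf P^e\in\mathcal G^e\}$. $\Psi$ is a family of subsets of $\mathcal K$, and $\mathcal P_\Psi=\{\mathsf P\in\mathcal P:\mathsf P^e\in\mathcal H^e\cup\mathcal G^e\ \forall e\in\mathcal K,\ \mathcal A(\mathsf P)\in\Psi\}$, $\mathcal H_0=\{\mathsf P\in\mathcal P:\mathsf P^e\in\mathcal H^e\ \forall e\in\mathcal K\}$, $\mathcal H_{\Psi,e}=\{\mathsf P\in\mathcal P_\Psi\setminus\mathcal H_0:e\notin\mathcal A(\mathsf P)\}$, $\mathcal G_{\Psi,e}=\{\mathsf P\in\mathcal P_\Psi:e\in\mathcal A(\mathsf P)\}$. Standing assumption: for every $e\in\mathcal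 K$, $\mathsf P\in\mathcal G_{\Psi,e}\cup\mathcal H_0$, $\mathsf Q\in\mathcal H_{\Psi,e}\cup\mathcal H_0$, $e\subseteq s\subseteq[K]$, $n\in\mathbb N$, the laws $\mathsf P^s,\mathsf Q^s$ are mutually absolutely continuous on $\mathcal F_n^s$, with likelihood ratio $\Lambda_n(\mathsf P^s,\mathsf Q^s)=\frac{d\mathsf P^s}{d\mathsf Q^s}(\mathcal F_n^s)$. Statistics. Each unit $e$ is assigned a detection subsystem $s_e$ and an isolation subsystem $s'_e$, with $e\subseteq s_e\cap s'_e$ and $s_e,s'_e\subseteq[K]$; $$\Lambda_{e,\rm det}(n)=\frac{\max\{\Lambda_n(\mathsf P,\mathsf P_0):\mathsf P\in\mathcal G_{\Psi,e}^{s_e}\}}{\max\{\Lambda_n(\mathsf P,\mathsf P_0):\mathsf P\in\mathcal H_0^{s_e}\}},\qquad \Lambda_{e,\rm iso}(n)=\frac{\max\{\Lambda_n(\mathsf P,\mathsf P_0'):\mathsf P\in\mathcal G_{\Psi,e}^{s'_e}\}}{\max\{\Lambda_n(\mathsf P,\mathsf P_0'):\mathsf P\in\mathcal H_{\Psi,e}^{s'_e}\}},$$ with $\mathsf P_0\in\mathcal H_0^{s_e}$, $\mathsf P'_0\in\mathcal H_0^{s'_e}$ arbitrary (families over which maxima are taken are tacitly nonempty). $D_{\rm iso}(n)=\{e\in\mathcal K:\Lambda_{e,\rm iso}(n)>1\}$. When $s_e=s'_e=e$, it is understood that $\mathcal G_{\Psi,e}^e=\mathcal G^e$ and $\mathcal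 H_{\Psi,e}^e=\mathcal H_0^e=\mathcal H^e$, so that both statistics coincide with the local statistic $\max\{\Lambda_n(\mathsf P,\mathsf P_0):\mathsf P\in\mathcal G^e\}/\max\{\Lambda_n(\mathsf P,\mathsf P_0):\mathsf P\in\mathcal H^e\}$. Tests. A test is a pair $(T,D)$ with $T$ an $\{\mathcal F_n\}$-stopping time and $D$ an $\mathcal F_T$-measurable, $\Psi$-valued decision; $\mathcal C_\Psi$ is the class of all tests. - $\mathcal D_\Psi(\alpha,\beta)$: tests with $\mathsf P(D\ne\emptyset)\le\alpha$ for all $\mathsf P\in\mathcal H_0$ and $\mathsf P(D=\emptyset)\le\beta$ for all $\mathsf P\in\mathcal P_\Psi\setminus\mathcal H_0$. - $\mathcal E_\Psi(\gamma,\delta)$: tests with $\mathsf P(D\setminus\mathcal A(\mathsf P)\ne\emptyset)\le\gamma$ and $\mathsf P(\mathcal A(\mathsf P)\setminus D\ne\emptyset)\le\delta$ for all $\mathsf P\in\mathcal P_\Psi$. - $\mathcal C_\Psi(\alpha,\beta,\gamma,\delta)$: tests in $\mathcal D_\Psi(\alpha,\beta)$ with $\mathsf P(D\setminus\mathcal A(\mathsf P)\ne\emptyset)\le\gamma$ and $\mathsf P(\mathcal A(\mathsf P)\setminus D\ne\emptyset,\,D\ne\emptyset)\le\delta$ for all $\mathsf P\in\mathcal P_\Psi\setminus\mathcal H_0$. Procedures ($\emptyset\in\Psi$), with thresholds $\{A_e,B_e,C_e,D_e\}_{e\in\mathcal K}$. Let $T_0=\inf\{n:\Lambda_{e,\rm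 det}(n)\le1/C_e\ \forall e\in\mathcal K\}$, $T_{det}=\inf\{n:\Lambda_{e,\rm det}(n)\ge D_e\text{ for some }e\in\mathcal K\}$, $T_{joint}=\inf\{n:\Lambda_{e,\rm det}(n)\ge D_e\text{ for some }e\in\mathcal K,\ \Lambda_{e,\rm iso}(n)\notin(1/A_e,B_e)\ \forall e\in\mathcal K,\ D_{\rm iso}(n)\in\Psi\setminus\{\emptyset\}\}$. - $\chi^*_{det}=(T^*_{det},D^*_{det})$: $T^*_{det}=\min\{T_0,T_{det}\}$, and $D^*_{det}=\emptyset$ iff $T_0<T_{det}$ (otherwise $D^*_{det}$ is some nonempty element of $\Psi$). - $\chi^*=(T^*,D^* )$: $T^*=\min\{T_0,T_{joint}\}$, $D^*=\emptyset$ if $T_0<T_{joint}$ and $D^*=D_{\rm iso}(T^* )$ if $T_{joint}<T_0$. - $\chi^*_{fwer}=(T^*_{fwer},D^*_{fwer})$: the test $\chi^*$ with $C_e=A_e$ and $D_e=B_e$ for every $e\in\mathcal K$. *)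

theory Defs
  imports "HOL-Probability.Probability"
begin

text \<open>
  A path is a function on pairs \<open>(n, k)\<close>: its value there is the observation from source \<open>k\<close> at
  time \<open>n\<close>. Times start at 1, and the observations may take values in a different measurable
  space for every \<open>(n, k)\<close>, all of them over one carrier type.
\<close>

type_synonym 'v path = "nat \<times> nat \<Rightarrow> 'v"

record 'v problem =
  nsrc :: nat
  obs_space :: "nat \<Rightarrow> nat \<Rightarrow> 'v measure"
  dists :: "'v path measure set"
  units :: "nat set set"
  nulls :: "nat set \<Rightarrow> 'v path measure set"
  alts :: "nat set \<Rightarrow> 'v path measure set"
  Psi :: "nat set set set"
  sdet :: "nat set \<Rightarrow> nat set"
  siso :: "nat set \<Rightarrow> nat set"
  refdet :: "nat set \<Rightarrow> 'v path measure"
  refiso :: "nat set \<Rightarrow> 'v path measure"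

definition sources :: "'v problem \<Rightarrow> nat set" where
  "sources Z = {1..nsrc Z}"


section \<open>Path spaces, laws, filtrations, likelihood ratios\<close>

definition path_space :: "'v problem \<Rightarrow> nat set \<Rightarrow> 'v path measure" where
  "path_space Z s = (\<Pi>\<^sub>M (n, k) \<in> {1..} \<times> s. obs_space Z n k)"

definition proj :: "nat set \<Rightarrow> 'v path \<Rightarrow> 'v path" where
  "proj s \<omega> = restrict \<omega> ({1..} \<times> s)"

text \<open>The law of \<open>X\<^sup>s\<close> under \<open>P\<close>.\<close>

definition law :: "'v problem \<Rightarrow> nat set \<Rightarrow> 'v path measure \<Rightarrow> 'v path measure" where
  "law Z s P = distr P (path_space Z s) (proj s)"

text \<open>
  \<open>filt Z s n\<close> is the sigma-algebra generated by \<open>X\<^sub>1\<^sup>s, \<dots>, X\<^sub>n\<^sup>s\<close> on the path space of \<open>s\<close>. The index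
  runs over \<open>enat\<close>, so that the library's stopping times may be infinite: at \<open>\<infinity>\<close> it
  is generated by all observations, at \<open>0\<close> it is trivial.
\<close>

definition filt :: "'v problem \<Rightarrow> nat set \<Rightarrow> enat \<Rightarrow> 'v path measure" where
  "filt Z s t = vimage_algebra (space (path_space Z s))
     (\<lambda>\<omega>. restrict \<omega> ({m. 1 \<le> m \<and> enat m \<le> t} \<times> s))
     (\<Pi>\<^sub>M (m, k) \<in> {m. 1 \<le> m \<and> enat m \<le> t} \<times> s. obs_space Z m k)"

definition mutually_ac :: "'v problem \<Rightarrow> nat set \<Rightarrow> nat \<Rightarrow> 'v path measure \<Rightarrow> 'v path measure \<Rightarrow> bool" where
  "mutually_ac Z s n P Q \<longleftrightarrow>
     absolutely_continuous (restr_to_subalg Q (filt Z s n)) (restr_to_subalg P (filt Z s n)) \<and>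
     absolutely_continuous (restr_to_subalg P (filt Z s n)) (restr_to_subalg Q (filt Z s n))"

text \<open>\<open>lr Z s n P Q\<close> is the derivative \<open>dP / dQ\<close> of two laws of \<open>X\<^sup>s\<close> on the time-\<open>n\<close> sigma-algebra.\<close>

definition lr :: "'v problem \<Rightarrow> nat set \<Rightarrow> nat \<Rightarrow> 'v path measure \<Rightarrow> 'v path measure \<Rightarrow> 'v path \<Rightarrow> ennreal" where
  "lr Z s n P Q = RN_deriv (restr_to_subalg Q (filt Z s n)) (restr_to_subalg P (filt Z s n))"


section \<open>Hypotheses\<close>

definition active :: "'v problem \<Rightarrow> 'v path measure \<Rightarrow> nat set set" where
  "active Z P = {e \<in> units Z. law Z e P \<in> alts Z e}"

definition P_Psi :: "'v problem \<Rightarrow> 'v path measure set" where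
  "P_Psi Z = {P \<in> dists Z. (\<forall>e\<in>units Z. law Z e P \<in> nulls Z e \<union> alts Z e) \<and> active Z P \<in> Psi Z}"

definition H_0 :: "'v problem \<Rightarrow> 'v path measure set" where
  "H_0 Z = {P \<in> dists Z. \<forall>e\<in>units Z. law Z e P \<in> nulls Z e}"

definition H_Psi :: "'v problem \<Rightarrow> nat set \<Rightarrow> 'v path measure set" where
  "H_Psi Z e = {P \<in> P_Psi Z - H_0 Z. e \<notin> active Z P}"

definition G_Psi :: "'v problem \<Rightarrow> nat set \<Rightarrow> 'v path measure set" where
  "G_Psi Z e = {P \<in> P_Psi Z. e \<in> active Z P}"

text \<open>
  The families \<open>G\<^sub>\<Psi>\<^sub>,\<^sub>e\<^sup>s\<close>, \<open>H\<^sub>\<Psi>\<^sub>,\<^sub>e\<^sup>s\<close>, \<open>H\<^sub>0\<^sup>s\<close> of laws of \<open>X\<^sup>s\<close> attached to a unit \<open>e\<close>. If both subsystems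
  of \<open>e\<close> equal \<open>e\<close>, then for \<open>s = e\<close> they are by convention the local alternative and (twice)
  the local null of \<open>e\<close>.
\<close>

definition local_unit :: "'v problem \<Rightarrow> nat set \<Rightarrow> bool" where
  "local_unit Z e \<longleftrightarrow> sdet Z e = e \<and> siso Z e = e"

definition G_laws :: "'v problem \<Rightarrow> nat set \<Rightarrow> nat set \<Rightarrow> 'v path measure set" where
  "G_laws Z e s = (if local_unit Z e \<and> s = e then alts Z e else law Z s ` G_Psi Z e)"

definition H_laws :: "'v problem \<Rightarrow> nat set \<Rightarrow> nat set \<Rightarrow> 'v path measure set" where
  "H_laws Z e s = (if local_unit Z e \<and> s = e then nulls Z e else law Z s ` H_Psi Z e)"

definition H0_laws :: "'v problem \<Rightarrow> nat set \<Rightarrow> nat set \<Rightarrow> 'v path measure set" where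
  "H0_laws Z e s = (if local_unit Z e \<and> s = e then nulls Z e else law Z s ` H_0 Z)"

text \<open>
  The assumption \<open>ac\<close> is about the families just defined, so that for local units it makes the
  likelihood ratios between local alternatives and local nulls well-defined. The last three
  assumptions say that the families over which maxima are taken are nonempty; for \<open>H\<^sub>0\<close> this is
  implied by the choice of reference laws, which are otherwise arbitrary.
\<close>

locale joint_problem =
  fixes Z :: "'v problem"
  assumes finite_dists: "finite (dists Z)"
    and prob_dists: "P \<in> dists Z \<Longrightarrow> prob_space P"
    and sets_dists: "P \<in> dists Z \<Longrightarrow> sets P = sets (path_space Z (sources Z))"
    and units: "units Z \<subseteq> Pow (sources Z)"
    and nulls: "e \<in> units Z \<Longrightarrow> nulls Z e \<subseteq> law Z e ` dists Z \<and> nulls Z e \<noteq> {}"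
    and alts: "e \<in> units Z \<Longrightarrow> alts Z e \<subseteq> law Z e ` dists Z \<and> alts Z e \<noteq> {}"
    and nulls_alts: "e \<in> units Z \<Longrightarrow> nulls Z e \<inter> alts Z e = {}"
    and Psi: "Psi Z \<subseteq> Pow (units Z)"
    and subsystems: "e \<in> units Z \<Longrightarrow>
      e \<subseteq> sdet Z e \<inter> siso Z e \<and> sdet Z e \<subseteq> sources Z \<and> siso Z e \<subseteq> sources Z"
    and ac: "\<lbrakk>e \<in> units Z; e \<subseteq> s; s \<subseteq> sources Z; 1 \<le> n;
      P \<in> G_laws Z e s \<union> H0_laws Z e s; Q \<in> H_laws Z e s \<union> H0_laws Z e s\<rbrakk> \<Longrightarrow> mutually_ac Z s n P Q"
    and refs: "e \<in> units Z \<Longrightarrow>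
      refdet Z e \<in> H0_laws Z e (sdet Z e) \<and> refiso Z e \<in> H0_laws Z e (siso Z e)"
    and G_det_nonempty: "e \<in> units Z \<Longrightarrow> G_laws Z e (sdet Z e) \<noteq> {}"
    and G_iso_nonempty: "e \<in> units Z \<Longrightarrow> G_laws Z e (siso Z e) \<noteq> {}"
    and H_iso_nonempty: "e \<in> units Z \<Longrightarrow> H_laws Z e (siso Z e) \<noteq> {}"


section \<open>Statistics\<close>

definition lr_max :: "'v problem \<Rightarrow> nat set \<Rightarrow> nat \<Rightarrow> 'v path measure set \<Rightarrow> 'v path measure \<Rightarrow> 'v path \<Rightarrow> ennreal" where
  "lr_max Z s n Ps Q \<omega> = Max ((\<lambda>P. lr Z s n P Q (proj s \<omega>)) ` Ps)"

definition L_det :: "'v problem \<Rightarrow> nat set \<Rightarrow> nat \<Rightarrow> 'v path \<Rightarrow> ennreal" where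
  "L_det Z e n \<omega> =
     lr_max Z (sdet Z e) n (G_laws Z e (sdet Z e)) (refdet Z e) \<omega> /
     lr_max Z (sdet Z e) n (H0_laws Z e (sdet Z e)) (refdet Z e) \<omega>"

definition L_iso :: "'v problem \<Rightarrow> nat set \<Rightarrow> nat \<Rightarrow> 'v path \<Rightarrow> ennreal" where
  "L_iso Z e n \<omega> =
     lr_max Z (siso Z e) n (G_laws Z e (siso Z e)) (refiso Z e) \<omega> /
     lr_max Z (siso Z e) n (H_laws Z e (siso Z e)) (refiso Z e) \<omega>"

definition D_iso :: "'v problem \<Rightarrow> nat \<Rightarrow> 'v path \<Rightarrow> nat set set" where
  "D_iso Z n \<omega> = {e \<in> units Z. L_iso Z e n \<omega> > 1}"


section \<open>Tests and error classes\<close>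

text \<open>\<open>F_at Z T\<close> is the sigma-algebra \<open>F\<^sub>T\<close> of a stopping time of the filtration of all sources.\<close>

definition F_at :: "'v problem \<Rightarrow> ('v path \<Rightarrow> enat) \<Rightarrow> 'v path measure" where
  "F_at Z T = filtration.pre_sigma (space (path_space Z (sources Z))) (filt Z (sources Z)) T"

type_synonym 'v test = "('v path \<Rightarrow> enat) \<times> ('v path \<Rightarrow> nat set set)"

definition tests :: "'v problem \<Rightarrow> 'v test set" where
  "tests Z = {(T, D). stopping_time (filt Z (sources Z)) T \<and>
     (\<forall>\<omega>\<in>space (path_space Z (sources Z)). 1 \<le> T \<omega>) \<and>
     D \<in> F_at Z T \<rightarrow>\<^sub>M count_space (Psi Z)}"

text \<open>
  Stopping times may be infinite, and a decision is made only upon stopping. So the probability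
  of a decision event is that of the event together with \<open>T < \<infinity>\<close>; the values of \<open>D\<close> where
  \<open>T = \<infinity>\<close> are immaterial.
\<close>

definition decides :: "'v path measure \<Rightarrow> 'v test \<Rightarrow> (nat set set \<Rightarrow> bool) \<Rightarrow> real" where
  "decides P \<xi> \<phi> = measure P {\<omega> \<in> space P. fst \<xi> \<omega> < \<infinity> \<and> \<phi> (snd \<xi> \<omega>)}"

definition detection_class :: "'v problem \<Rightarrow> real \<Rightarrow> real \<Rightarrow> 'v test set" where
  "detection_class Z \<alpha> \<beta> = {\<xi> \<in> tests Z.
     (\<forall>P\<in>H_0 Z. decides P \<xi> (\<lambda>D. D \<noteq> {}) \<le> \<alpha>) \<and>
     (\<forall>P\<in>P_Psi Z - H_0 Z. decides P \<xi> (\<lambda>D. D = {}) \<le> \<beta>)}"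

definition fwer_class :: "'v problem \<Rightarrow> real \<Rightarrow> real \<Rightarrow> 'v test set" where
  "fwer_class Z \<gamma> \<delta> = {\<xi> \<in> tests Z. \<forall>P\<in>P_Psi Z.
     decides P \<xi> (\<lambda>D. D - active Z P \<noteq> {}) \<le> \<gamma> \<and>
     decides P \<xi> (\<lambda>D. active Z P - D \<noteq> {}) \<le> \<delta>}"

definition joint_class :: "'v problem \<Rightarrow> real \<Rightarrow> real \<Rightarrow> real \<Rightarrow> real \<Rightarrow> 'v test set" where
  "joint_class Z \<alpha> \<beta> \<gamma> \<delta> = {\<xi> \<in> detection_class Z \<alpha> \<beta>. \<forall>P\<in>P_Psi Z - H_0 Z.
     decides P \<xi> (\<lambda>D. D - active Z P \<noteq> {}) \<le> \<gamma> \<and>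
     decides P \<xi> (\<lambda>D. active Z P - D \<noteq> {} \<and> D \<noteq> {}) \<le> \<delta>}"


section \<open>Procedures\<close>

text \<open>\<open>first_time \<phi>\<close> is the infimum of the times \<open>n \<ge> 1\<close> satisfying \<open>\<phi>\<close>; it is \<open>\<infinity>\<close> if there are none.\<close>

definition first_time :: "(nat \<Rightarrow> bool) \<Rightarrow> enat" where
  "first_time \<phi> = (INF n\<in>{n. 1 \<le> n \<and> \<phi> n}. enat n)"

definition T_0 :: "'v problem \<Rightarrow> (nat set \<Rightarrow> real) \<Rightarrow> 'v path \<Rightarrow> enat" where
  "T_0 Z C \<omega> = first_time (\<lambda>n. \<forall>e\<in>units Z. L_det Z e n \<omega> \<le> ennreal (1 / C e))"

definition T_det :: "'v problem \<Rightarrow> (nat set \<Rightarrow> real) \<Rightarrow> 'v path \<Rightarrow> enat" where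
  "T_det Z D \<omega> = first_time (\<lambda>n. \<exists>e\<in>units Z. L_det Z e n \<omega> \<ge> ennreal (D e))"

definition T_joint :: "'v problem \<Rightarrow> (nat set \<Rightarrow> real) \<Rightarrow> (nat set \<Rightarrow> real) \<Rightarrow> (nat set \<Rightarrow> real) \<Rightarrow> 'v path \<Rightarrow> enat" where
  "T_joint Z A B D \<omega> = first_time (\<lambda>n.
     (\<exists>e\<in>units Z. L_det Z e n \<omega> \<ge> ennreal (D e)) \<and>
     (\<forall>e\<in>units Z. L_iso Z e n \<omega> \<notin> {ennreal (1 / A e) <..< ennreal (B e)}) \<and>
     D_iso Z n \<omega> \<in> Psi Z - {{}})"

definition T_star_det :: "'v problem \<Rightarrow> (nat set \<Rightarrow> real) \<Rightarrow> (nat set \<Rightarrow> real) \<Rightarrow> 'v path \<Rightarrow> enat" where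
  "T_star_det Z C D \<omega> = min (T_0 Z C \<omega>) (T_det Z D \<omega>)"

text \<open>The argument \<open>\<psi>\<close> is the rule choosing a nonempty element of \<open>\<Psi>\<close> when the null is rejected.\<close>

definition chi_det :: "'v problem \<Rightarrow> (nat set \<Rightarrow> real) \<Rightarrow> (nat set \<Rightarrow> real) \<Rightarrow> ('v path \<Rightarrow> nat set set) \<Rightarrow> 'v test" where
  "chi_det Z C D \<psi> = (T_star_det Z C D, \<lambda>\<omega>. if T_0 Z C \<omega> < T_det Z D \<omega> then {} else \<psi> \<omega>)"

text \<open>
  The tie \<open>T_0 = T_joint\<close> has two cases. If both are infinite, no decision is made and \<open>{}\<close>
  is a placeholder. A finite tie cannot occur when all \<open>C e\<close> and \<open>D e\<close> exceed 1, for then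
  \<open>1 / C e < D e\<close>.
\<close>

definition chi_star :: "'v problem \<Rightarrow> (nat set \<Rightarrow> real) \<Rightarrow> (nat set \<Rightarrow> real) \<Rightarrow> (nat set \<Rightarrow> real) \<Rightarrow> (nat set \<Rightarrow> real) \<Rightarrow> 'v test" where
  "chi_star Z A B C D =
     (\<lambda>\<omega>. min (T_0 Z C \<omega>) (T_joint Z A B D \<omega>),
      \<lambda>\<omega>. if T_joint Z A B D \<omega> < T_0 Z C \<omega> then D_iso Z (the_enat (T_joint Z A B D \<omega>)) \<omega> else {})"

definition chi_fwer :: "'v problem \<Rightarrow> (nat set \<Rightarrow> real) \<Rightarrow> (nat set \<Rightarrow> real) \<Rightarrow> 'v test" where
  "chi_fwer Z A B = chi_star Z A B A B"


section \<open>Cardinalities of the families\<close>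

definition card_a :: "'v problem \<Rightarrow> nat set \<Rightarrow> real" where
  "card_a Z e = real (card (H_laws Z e (siso Z e)))"

definition card_b :: "'v problem \<Rightarrow> nat set \<Rightarrow> real" where
  "card_b Z e = real (card (G_laws Z e (siso Z e)))"

definition card_c :: "'v problem \<Rightarrow> nat set \<Rightarrow> real" where
  "card_c Z e = real (card (H0_laws Z e (sdet Z e)))"

definition card_d :: "'v problem \<Rightarrow> nat set \<Rightarrow> real" where
  "card_d Z e = real (card (G_laws Z e (sdet Z e)))"

end

theory Submission
  imports Defs
begin

text \<open>
  Every error of the procedures forces one of finitely many likelihood ratios of an incorrect law
  against the true law to reach a threshold, and by Ville's inequality a likelihood ratio reaches
  the level \<open>c\<close> at some time with probability at most \<open>1 / c\<close> under the law in its denominator.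

  Ville's inequality is obtained from first passage (\<open>adapted_union_le\<close>, \<open>likelihood_ratio_crossing\<close>).
  On a time-\<open>n\<close> event \<open>A\<close> inside \<open>{dQ/dr \<ge> c \<cdot> dP/dr}\<close>, integration over \<open>A\<close> gives \<open>c P(A) \<le> Q(A)\<close>;
  the event of ever crossing is the disjoint union, over \<open>n\<close>, of first crossings at time \<open>n\<close>, so it
  has \<open>c\<close> times its \<open>P\<close>-probability bounded by a \<open>Q\<close>-probability, hence by 1. Comparing both laws
  with the reference law \<open>r\<close> that the statistics use keeps all comparisons pointwise.

  If the true law belongs to the family in the denominator of a statistic, a value \<open>\<ge> c\<close> makes some
  ratio of a law of the numerator family to the true law at least \<open>c\<close>; if it belongs to the
  numerator family, a value \<open>\<le> 1 / c\<close> makes some ratio of a law of the denominator family to the true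
  law at least \<open>c\<close>. A union over the competing family yields the bounds \<open>d\<^sub>e / D\<^sub>e\<close>, \<open>c\<^sub>e / C\<^sub>e\<close>, \<open>b\<^sub>e / B\<^sub>e\<close>
  and \<open>a\<^sub>e / A\<^sub>e\<close> (the lemmas \<open>prob_L_det_large_le\<close> to \<open>prob_L_iso_small_le\<close>).

  It remains to locate the errors. A false alarm makes some detection statistic reach \<open>D\<^sub>e\<close>. A missed
  detection brings all detection statistics down to \<open>1 / C\<^sub>e\<close>, in particular that of one active unit,
  which costs a single term. Since \<open>1 / A\<^sub>e < 1 < B\<^sub>e\<close>, a unit is selected by the joint stopping rule
  only if its isolation statistic is at least \<open>B\<^sub>e\<close>, and left out only if it is at most \<open>1 / A\<^sub>e\<close>; each of
  the two isolation errors is thus a union over at most \<open>|K|\<close> units. For the familywise error of the second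
  kind, the \<open>|K|\<close> isolation terms and the one detection term share the level, whence the factor
  \<open>|K| + 1\<close>. When the subsystems of every unit are the unit itself, both statistics are the same up to
  the choice of reference law, so the detection term is already contained in the isolation term of an
  active unit and the factor is \<open>|K|\<close>.

  Finally, the procedures are tests: the statistics at time \<open>n\<close> depend measurably on the
  observations up to time \<open>n\<close>, and on the event that \<open>\<chi>\<^sup>*\<close> rejects the null, its decision
  is \<open>D\<^sub>i\<^sub>s\<^sub>o\<close> at a finite time.
\<close>


section \<open>Ville's inequality by first passage\<close>

text \<open>
  Disjointing the events \<open>E n\<close> by the first index at which one occurs keeps the \<open>n\<close>-th piece in \<open>F n\<close>,
  where the domination hypothesis applies to it; summing the pieces leaves the \<open>q\<close>-probability of a
  single event.
\<close>

lemma adapted_union_le: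
  fixes p q :: "'a measure" and F :: "nat \<Rightarrow> 'a measure" and E :: "nat \<Rightarrow> 'a set" and c :: ennreal
  assumes q: "prob_space q" and sets_pq: "sets p = sets q"
    and sub: "\<And>n. sets (F n) \<subseteq> sets q" and mono: "\<And>m n. m \<le> n \<Longrightarrow> sets (F m) \<subseteq> sets (F n)"
    and E: "\<And>n. E n \<in> sets (F n)"
    and dom: "\<And>n A. A \<in> sets (F n) \<Longrightarrow> A \<subseteq> E n \<Longrightarrow> c * emeasure p A \<le> emeasure q A"
  shows "c * emeasure p (\<Union>n. E n) \<le> 1"
proof -
  have D: "disjointed E n \<in> sets (F n)" for n
  proof -
    have "E i \<in> sets (F n)" if "i \<le> n" for i
      using E[of i] mono[OF that] by blast
    then show ?thesis
      by (auto simp: disjointed_def)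
  qed
  then have Dq: "range (disjointed E) \<subseteq> sets q"
    using sub by blast
  have "c * emeasure p (\<Union>n. E n) = c * (\<Sum>n. emeasure p (disjointed E n))"
    using Dq suminf_emeasure[of "disjointed E" p]
    by (simp add: sets_pq disjoint_family_disjointed UN_disjointed_eq)
  also have "\<dots> = (\<Sum>n. c * emeasure p (disjointed E n))"
    by simp
  also have "\<dots> \<le> (\<Sum>n. emeasure q (disjointed E n))"
    using D by (intro suminf_le dom) (auto intro: disjointed_subset[THEN subsetD])
  also have "\<dots> = emeasure q (\<Union>n. E n)"
    using Dq suminf_emeasure[of "disjointed E" q]
    by (simp add: disjoint_family_disjointed UN_disjointed_eq)
  also have "\<dots> \<le> 1"
    using q by (rule prob_space.emeasure_le_1)
  finally show ?thesis .
qed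

text \<open>
  The hypotheses on the measures concern the single set \<open>A\<close>, so that \<open>p\<close> and \<open>q\<close> may live on a larger
  sigma-algebra than the one on which they have densities.
\<close>

lemma dominated_where_density_ge:
  fixes c :: ennreal
  assumes [measurable]: "f \<in> borel_measurable r" "g \<in> borel_measurable r" "A \<in> sets r"
    and p: "emeasure p A = (\<integral>\<^sup>+x\<in>A. g x \<partial>r)" and q: "emeasure q A = (\<integral>\<^sup>+x\<in>A. f x \<partial>r)"
    and le: "\<And>x. x \<in> A \<Longrightarrow> c * g x \<le> f x"
  shows "c * emeasure p A \<le> emeasure q A"
proof -
  have "c * emeasure p A = (\<integral>\<^sup>+x. c * (g x * indicator A x) \<partial>r)"
    unfolding p by (simp add: nn_integral_cmult)
  also have "\<dots> \<le> emeasure q A"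
    unfolding q by (intro nn_integral_mono) (auto simp: indicator_def le)
  finally show ?thesis .
qed

text \<open>
  The conventions \<open>a / 0 = \<infinity>\<close> for \<open>a > 0\<close>, \<open>0 / 0 = 0\<close> and \<open>a / \<infinity> = 0\<close> make this and its companion valid for
  all extended values, so that degenerate likelihood ratios require no exceptional null set.
\<close>

lemma ennreal_ratio_ge:
  fixes a b :: ennreal
  assumes "ennreal c \<le> a / b" "0 < c"
  shows "ennreal c * b \<le> a"
proof (cases "b = 0 \<or> b = top")
  case True
  then show ?thesis using assms by (auto simp: ennreal_eq_0_iff)
next
  case False
  then have "ennreal c * b \<le> a / b * b"
    using assms by (intro mult_right_mono) auto
  also have "\<dots> = a"
    using False by (metis ennreal_times_divide mult.commute mult_divide_eq_ennreal)
  finally show ?thesis .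
qed

lemma ennreal_ratio_le:
  fixes a b :: ennreal
  assumes "a / b \<le> ennreal (1 / c)" "0 < c"
  shows "ennreal c * a \<le> b"
proof (cases "b = 0 \<or> b = top")
  case True
  then show ?thesis using assms by (auto split: if_splits simp: top_unique)
next
  case False
  have "ennreal c * a = ennreal c * (a / b * b)"
    using False by (metis ennreal_times_divide mult.commute mult_divide_eq_ennreal)
  also have "\<dots> \<le> ennreal c * (ennreal (1 / c) * b)"
    using assms by (intro mult_left_mono mult_right_mono) auto
  also have "\<dots> = b"
    using assms by (simp flip: mult.assoc ennreal_mult)
  finally show ?thesis .
qed


section \<open>Paths and their filtration\<close>

lemma restrict_time_measurable:
  "(\<lambda>\<omega>. restrict \<omega> ({m. 1 \<le> m \<and> enat m \<le> t} \<times> s)) \<in>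
    path_space Z s \<rightarrow>\<^sub>M (\<Pi>\<^sub>M (m, k) \<in> {m. 1 \<le> m \<and> enat m \<le> t} \<times> s. obs_space Z m k)"
  unfolding path_space_def by (intro measurable_restrict_subset) auto

lemma space_filt [simp]: "space (filt Z s t) = space (path_space Z s)"
  by (simp add: filt_def)

lemma subalgebra_filt:
  assumes "sets M = sets (path_space Z s)"
  shows "subalgebra M (filt Z s t)"
proof -
  have "sets (filt Z s t) \<subseteq> sets (path_space Z s)"
    unfolding filt_def by (rule sets_image_in_sets[OF refl restrict_time_measurable])
  then show ?thesis
    using assms sets_eq_imp_space_eq[OF assms] by (simp add: subalgebra_def)
qed

lemma restrict_time_measurable_filt:
  "(\<lambda>\<omega>. restrict \<omega> ({m. 1 \<le> m \<and> enat m \<le> t} \<times> s)) \<in>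
    filt Z s t \<rightarrow>\<^sub>M (\<Pi>\<^sub>M (m, k) \<in> {m. 1 \<le> m \<and> enat m \<le> t} \<times> s. obs_space Z m k)"
  unfolding filt_def using measurable_space[OF restrict_time_measurable[where Z=Z]]
  by (intro measurable_vimage_algebra1) auto

lemma proj_measurable:
  assumes "s \<subseteq> s'"
  shows "proj s \<in> path_space Z s' \<rightarrow>\<^sub>M path_space Z s"
  unfolding path_space_def proj_def using assms by (intro measurable_restrict_subset) auto

text \<open>
  The observations of the subsystem \<open>s\<close> up to time \<open>u\<close> are among those of \<open>s'\<close> up to time \<open>t\<close>. With
  \<open>s = s'\<close> this says that the filtration is increasing.
\<close>

lemma proj_measurable_filt:
  assumes "s \<subseteq> s'" "u \<le> t"
  shows "proj s \<in> filt Z s' t \<rightarrow>\<^sub>M filt Z s u"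
proof -
  let ?I = "{m. 1 \<le> m \<and> enat m \<le> t} \<times> s'" and ?J = "{m. 1 \<le> m \<and> enat m \<le> u} \<times> s"
  have sub: "?J \<subseteq> ?I"
    using assms order_trans by auto
  have "(\<lambda>\<omega>. restrict \<omega> ?J) \<circ> (\<lambda>\<omega>. restrict \<omega> ?I) \<in>
      filt Z s' t \<rightarrow>\<^sub>M (\<Pi>\<^sub>M (m, k) \<in> ?J. obs_space Z m k)"
    by (rule measurable_comp[OF restrict_time_measurable_filt measurable_restrict_subset[OF sub]])
  also have "(\<lambda>\<omega>. restrict \<omega> ?J) \<circ> (\<lambda>\<omega>. restrict \<omega> ?I) = (\<lambda>\<omega>. restrict (proj s \<omega>) ?J)"
    using sub assms by (auto simp: fun_eq_iff proj_def restrict_def)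
  finally have "(\<lambda>\<omega>. restrict (proj s \<omega>) ?J) \<in> filt Z s' t \<rightarrow>\<^sub>M (\<Pi>\<^sub>M (m, k) \<in> ?J. obs_space Z m k)" .
  then show ?thesis
    using measurable_space[OF proj_measurable[OF assms(1), of Z]]
    unfolding filt_def[of Z s u] by (intro measurable_vimage_algebra2) auto
qed

lemma sets_filt_mono:
  assumes "u \<le> t"
  shows "sets (filt Z s u) \<subseteq> sets (filt Z s t)"
proof
  fix A assume A: "A \<in> sets (filt Z s u)"
  then have sp: "A \<subseteq> space (path_space Z s)"
    using sets.sets_into_space by fastforce
  have "proj s \<omega> = \<omega>" if "\<omega> \<in> space (path_space Z s)" for \<omega>
    using that by (simp add: proj_def path_space_def space_PiM)
  then have "proj s -` A \<inter> space (filt Z s t) = A"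
    using sp by auto
  then show "A \<in> sets (filt Z s t)"
    using measurable_sets[OF proj_measurable_filt[OF order_refl assms] A] by simp
qed

lemma filtration_filt: "filtration (space (path_space Z s)) (filt Z s)"
  by (intro filtration.intro sets_filt_mono) simp


section \<open>Likelihood ratios on the path space\<close>

lemma sets_law [simp]: "sets (law Z s P) = sets (path_space Z s)"
  by (simp add: law_def)

lemma mutually_ac_sym: "mutually_ac Z s n P Q \<Longrightarrow> mutually_ac Z s n Q P"
  by (auto simp: mutually_ac_def)

lemma lr_measurable:
  assumes "sets r = sets (path_space Z s)"
  shows "lr Z s n q r \<in> borel_measurable (filt Z s n)"
  using borel_measurable_RN_deriv[of "restr_to_subalg r (filt Z s n)"]
    sets_restr_to_subalg[OF subalgebra_filt[OF assms, of n]]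
  by (simp add: lr_def cong: measurable_cong_sets)

lemma emeasure_eq_integral_lr:
  assumes q: "sets q = sets (path_space Z s)" and r: "sets r = sets (path_space Z s)" "prob_space r"
    and ac: "mutually_ac Z s n q r" and A: "A \<in> sets (filt Z s n)"
  shows "emeasure q A = (\<integral>\<^sup>+x\<in>A. lr Z s n q r x \<partial>restr_to_subalg r (filt Z s n))"
proof -
  let ?r = "restr_to_subalg r (filt Z s n)" and ?q = "restr_to_subalg q (filt Z s n)"
  note sub = subalgebra_filt[OF q, of n] subalgebra_filt[OF r(1), of n]
  interpret prob_space ?r
    by (rule prob_space_restr_to_subalg[OF sub(2) r(2)])
  have "density ?r (lr Z s n q r) = ?q"
    unfolding lr_def using ac
    by (intro density_RN_deriv) (simp_all add: mutually_ac_def sets_restr_to_subalg sub)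
  then have "emeasure ?q A = (\<integral>\<^sup>+x\<in>A. lr Z s n q r x \<partial>?r)"
    using A by (metis borel_measurable_RN_deriv emeasure_density lr_def sets_restr_to_subalg sub(2))
  then show ?thesis
    using A by (simp add: emeasure_restr_to_subalg sub)
qed

context joint_problem
begin

lemma proj_measurable_dists:
  assumes "P \<in> dists Z" "s \<subseteq> sources Z"
  shows "proj s \<in> P \<rightarrow>\<^sub>M path_space Z s"
  using proj_measurable[OF assms(2), of Z] sets_dists[OF assms(1)]
  by (simp cong: measurable_cong_sets)

lemma space_dists: "P \<in> dists Z \<Longrightarrow> space P = space (path_space Z (sources Z))"
  using sets_dists sets_eq_imp_space_eq by blast

lemma prob_space_law:
  assumes "P \<in> dists Z" "s \<subseteq> sources Z"
  shows "prob_space (law Z s P)"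
  unfolding law_def by (intro prob_space.prob_space_distr prob_dists proj_measurable_dists assms)

text \<open>
  Two reference laws are admitted at once: the crossing times with respect to \<open>r\<close> and \<open>r'\<close> may differ,
  but the time-\<open>n\<close> crossing event of either is dominated, and domination passes to their union. The
  combined event therefore still has probability at most \<open>1 / c\<close>, not \<open>2 / c\<close>. This matters for local
  units, whose detection and isolation statistics may use different reference laws.
\<close>

lemma likelihood_ratio_crossing:
  fixes c :: real
  assumes P: "P \<in> dists Z" and s: "s \<subseteq> sources Z" and c: "0 < c"
    and laws: "q \<in> law Z s ` dists Z" "r \<in> law Z s ` dists Z" "r' \<in> law Z s ` dists Z"
    and ac: "\<And>n. 1 \<le> n \<Longrightarrow> mutually_ac Z s n q r" "\<And>n. 1 \<le> n \<Longrightarrow> mutually_ac Z s n q r'"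
      "\<And>n. 1 \<le> n \<Longrightarrow> mutually_ac Z s n (law Z s P) r" "\<And>n. 1 \<le> n \<Longrightarrow> mutually_ac Z s n (law Z s P) r'"
  defines "X \<equiv> {\<omega> \<in> space P. \<exists>n\<ge>1. c * lr Z s n (law Z s P) r (proj s \<omega>) \<le> lr Z s n q r (proj s \<omega>) \<or>
      c * lr Z s n (law Z s P) r' (proj s \<omega>) \<le> lr Z s n q r' (proj s \<omega>)}"
  shows "X \<in> sets P" and "measure P X \<le> 1 / c"
proof -
  let ?p = "law Z s P" and ?F = "\<lambda>n::nat. filt Z s n"
  define B where "B u n = {x \<in> space (path_space Z s). 1 \<le> n \<and> c * lr Z s n ?p u x \<le> lr Z s n q u x}"
    for u and n :: nat
  define E where "E n = B r n \<union> B r' n" for n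
  have sets_laws: "sets q = sets (path_space Z s)" "sets r = sets (path_space Z s)"
    "sets r' = sets (path_space Z s)" and prob: "prob_space q" "prob_space r" "prob_space r'"
    using laws s by (auto intro: prob_space_law)
  have B: "B u n \<in> sets (?F n)" if "u \<in> {r, r'}" for u n
  proof -
    have "sets u = sets (path_space Z s)"
      using that sets_laws by blast
    then have "{x \<in> space (?F n). c * lr Z s n ?p u x \<le> lr Z s n q u x} \<in> sets (?F n)"
      by (intro borel_measurable_le borel_measurable_times_ennreal measurable_const lr_measurable) auto
    then show ?thesis
      by (cases "1 \<le> n") (auto simp: B_def)
  qed
  have dom: "ennreal c * emeasure ?p A \<le> emeasure q A"
    if u: "u \<in> {r, r'}" and A: "A \<in> sets (?F n)" "A \<subseteq> B u n" for u A n
  proof (cases "A = {}")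
    case False
    with A(2) have n: "1 \<le> n"
      by (auto simp: B_def)
    have su: "sets u = sets (path_space Z s)" and pu: "prob_space u"
      and acu: "mutually_ac Z s n q u" "mutually_ac Z s n ?p u"
      using u sets_laws prob ac n by auto
    let ?u = "restr_to_subalg u (?F n)"
    have sets_u: "sets ?u = sets (?F n)"
      using subalgebra_filt[OF su] by (rule sets_restr_to_subalg)
    show ?thesis
    proof (rule dominated_where_density_ge[where r = ?u and f = "lr Z s n q u" and g = "lr Z s n ?p u"])
      show "emeasure ?p A = (\<integral>\<^sup>+x\<in>A. lr Z s n ?p u x \<partial>?u)"
        using su pu acu A by (intro emeasure_eq_integral_lr) auto
      show "emeasure q A = (\<integral>\<^sup>+x\<in>A. lr Z s n q u x \<partial>?u)"
        using su pu acu A sets_laws by (intro emeasure_eq_integral_lr) auto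
      show "ennreal c * lr Z s n ?p u x \<le> lr Z s n q u x" if "x \<in> A" for x
        using that A by (auto simp: B_def)
    qed (use A sets_u lr_measurable[OF su] in \<open>auto cong: measurable_cong_sets\<close>)
  qed simp
  have "ennreal c * emeasure ?p (\<Union>n. E n) \<le> 1"
  proof (rule adapted_union_le[where F = ?F and q = q])
    show "E n \<in> sets (?F n)" for n
      using B by (auto simp: E_def)
    show "sets (?F n) \<subseteq> sets q" for n
      using subalgebra_filt[OF sets_laws(1)] by (simp add: subalgebra_def)
    show "sets (?F m) \<subseteq> sets (?F n)" if "m \<le> n" for m n
      using that by (intro sets_filt_mono) simp
    show "ennreal c * emeasure ?p A \<le> emeasure q A" if A: "A \<in> sets (?F n)" "A \<subseteq> E n" for n A
    proof -
      \<comment> \<open>Where both ratios cross, the first one is used.\<close>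
      let ?A1 = "A \<inter> B r n" and ?A2 = "A - B r n"
      have s12: "?A1 \<in> sets (?F n)" "?A2 \<in> sets (?F n)"
        using A B[of r n] by auto
      have "sets (?F n) \<subseteq> sets (path_space Z s)"
        using subalgebra_filt[OF refl, where s = s and Z = Z and t = n] by (simp add: subalgebra_def)
      with s12 have s12': "?A1 \<in> sets (path_space Z s)" "?A2 \<in> sets (path_space Z s)"
        by auto
      have split: "emeasure v A = emeasure v ?A1 + emeasure v ?A2"
        if "sets v = sets (path_space Z s)" for v
      proof -
        have "emeasure v ?A1 + emeasure v ?A2 = emeasure v (?A1 \<union> ?A2)"
          using s12' that by (intro plus_emeasure) auto
        also have "?A1 \<union> ?A2 = A" by auto
        finally show ?thesis by simp
      qed
      have "ennreal c * emeasure ?p A = ennreal c * emeasure ?p ?A1 + ennreal c * emeasure ?p ?A2"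
        by (simp add: split distrib_left)
      also have "\<dots> \<le> emeasure q ?A1 + emeasure q ?A2"
        using s12 A by (intro add_mono dom[of r] dom[of r']) (auto simp: E_def)
      also have "\<dots> = emeasure q A"
        using split[OF sets_laws(1)] by simp
      finally show ?thesis .
    qed
  qed (use prob sets_laws in auto)
  moreover have E: "(\<Union>n. E n) \<in> sets (path_space Z s)"
  proof (intro sets.countable_UN image_subsetI)
    fix n
    have "sets (?F n) \<subseteq> sets (path_space Z s)"
      using subalgebra_filt[OF refl, where s = s and Z = Z and t = n] by (simp add: subalgebra_def)
    then show "E n \<in> sets (path_space Z s)"
      using B[of r n] B[of r' n] by (auto simp: E_def)
  qed
  moreover have X: "X = proj s -` (\<Union>n. E n) \<inter> space P"
    using measurable_space[OF proj_measurable_dists[OF P s]] by (auto simp: X_def E_def B_def)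
  ultimately have "ennreal c * emeasure P X \<le> 1"
    by (simp add: law_def emeasure_distr proj_measurable_dists[OF P s])
  interpret P: prob_space P
    by (rule prob_dists[OF P])
  have "c * measure P X \<le> 1"
    using c \<open>ennreal c * emeasure P X \<le> 1\<close> by (simp add: P.emeasure_eq_measure flip: ennreal_mult')
  then show "measure P X \<le> 1 / c"
    using c by (simp add: field_simps)
  show "X \<in> sets P"
    unfolding X using E by (intro measurable_sets[OF proj_measurable_dists[OF P s]])
qed

end

section \<open>Large and small values of the statistics\<close>

text \<open>
  The law \<open>p\<close> competes in the denominator, whose maximum is thus at least the likelihood of \<open>p\<close>, while
  the maximum in the numerator is attained.
\<close>

lemma lr_max_ratio_ge:
  assumes "finite Gs" "Gs \<noteq> {}" "finite Hs" "p \<in> Hs" "0 < c"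
    and "ennreal c \<le> lr_max Z s n Gs r \<omega> / lr_max Z s n Hs r \<omega>"
  shows "\<exists>q\<in>Gs. ennreal c * lr Z s n p r (proj s \<omega>) \<le> lr Z s n q r (proj s \<omega>)"
proof -
  have "lr_max Z s n Gs r \<omega> \<in> (\<lambda>P. lr Z s n P r (proj s \<omega>)) ` Gs"
    unfolding lr_max_def using assms by (intro Max_in) auto
  then obtain q where q: "q \<in> Gs" "lr_max Z s n Gs r \<omega> = lr Z s n q r (proj s \<omega>)"
    by blast
  have "ennreal c * lr Z s n p r (proj s \<omega>) \<le> ennreal c * lr_max Z s n Hs r \<omega>"
    using assms by (intro mult_left_mono) (auto simp: lr_max_def)
  also have "\<dots> \<le> lr_max Z s n Gs r \<omega>"
    using assms by (intro ennreal_ratio_ge)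
  finally show ?thesis
    using q by auto
qed

lemma lr_max_ratio_le:
  assumes "finite Gs" "p \<in> Gs" "finite Hs" "Hs \<noteq> {}" "0 < c"
    and "lr_max Z s n Gs r \<omega> / lr_max Z s n Hs r \<omega> \<le> ennreal (1 / c)"
  shows "\<exists>q\<in>Hs. ennreal c * lr Z s n p r (proj s \<omega>) \<le> lr Z s n q r (proj s \<omega>)"
proof -
  have "lr_max Z s n Hs r \<omega> \<in> (\<lambda>P. lr Z s n P r (proj s \<omega>)) ` Hs"
    unfolding lr_max_def using assms by (intro Max_in) auto
  then obtain q where q: "q \<in> Hs" "lr_max Z s n Hs r \<omega> = lr Z s n q r (proj s \<omega>)"
    by blast
  have "ennreal c * lr Z s n p r (proj s \<omega>) \<le> ennreal c * lr_max Z s n Gs r \<omega>"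
    using assms by (intro mult_left_mono) (auto simp: lr_max_def)
  also have "\<dots> \<le> lr_max Z s n Hs r \<omega>"
    using assms by (intro ennreal_ratio_le)
  finally show ?thesis
    using q by auto
qed

lemma lr_max_measurable:
  assumes "finite Ps" "sets r = sets (path_space Z s)" "s \<subseteq> s'" "enat n \<le> t"
  shows "lr_max Z s n Ps r \<in> borel_measurable (filt Z s' t)"
  unfolding lr_max_def
  by (rule borel_measurable_Max[OF assms(1)])
    (rule measurable_compose[OF proj_measurable_filt[OF assms(3,4)] lr_measurable[OF assms(2)]])

context joint_problem
begin

lemma finite_units: "finite (units Z)"
  using units by (rule finite_subset) (simp add: sources_def)

lemma laws_subset:
  assumes "e \<in> units Z"
  shows "G_laws Z e s \<subseteq> law Z s ` dists Z" "H_laws Z e s \<subseteq> law Z s ` dists Z"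
    "H0_laws Z e s \<subseteq> law Z s ` dists Z"
  using alts[OF assms] nulls[OF assms]
  by (auto simp: G_laws_def H_laws_def H0_laws_def G_Psi_def H_Psi_def H_0_def P_Psi_def)

lemma finite_laws:
  assumes "e \<in> units Z"
  shows "finite (G_laws Z e s)" "finite (H_laws Z e s)" "finite (H0_laws Z e s)"
  using laws_subset[OF assms, THEN finite_subset, OF finite_imageI[OF finite_dists]]
  by blast+

lemma law_in_G_laws: "P \<in> G_Psi Z e \<Longrightarrow> law Z s P \<in> G_laws Z e s"
  by (auto simp: G_laws_def G_Psi_def active_def)

lemma law_in_H_laws: "e \<in> units Z \<Longrightarrow> P \<in> H_Psi Z e \<Longrightarrow> law Z s P \<in> H_laws Z e s"
  by (auto simp: H_laws_def H_Psi_def active_def P_Psi_def)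

lemma law_in_H0_laws: "e \<in> units Z \<Longrightarrow> P \<in> H_0 Z \<Longrightarrow> law Z s P \<in> H0_laws Z e s"
  by (auto simp: H0_laws_def H_0_def)

lemma ref_laws:
  assumes "e \<in> units Z"
  shows "refdet Z e \<in> law Z (sdet Z e) ` dists Z" "refiso Z e \<in> law Z (siso Z e) ` dists Z"
  using refs[OF assms] laws_subset(3)[OF assms] by auto

lemma sets_refs:
  assumes "e \<in> units Z"
  shows "sets (refdet Z e) = sets (path_space Z (sdet Z e))"
    "sets (refiso Z e) = sets (path_space Z (siso Z e))"
  using ref_laws[OF assms] by auto

lemma L_measurable:
  assumes e: "e \<in> units Z" and n: "enat n \<le> t"
  shows "L_det Z e n \<in> borel_measurable (filt Z (sources Z) t)"
    and "L_iso Z e n \<in> borel_measurable (filt Z (sources Z) t)"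
proof -
  show "L_det Z e n \<in> borel_measurable (filt Z (sources Z) t)"
    unfolding L_det_def using subsystems[OF e]
    by (intro borel_measurable_divide_ennreal lr_max_measurable finite_laws e sets_refs n) blast+
  show "L_iso Z e n \<in> borel_measurable (filt Z (sources Z) t)"
    unfolding L_iso_def using subsystems[OF e]
    by (intro borel_measurable_divide_ennreal lr_max_measurable finite_laws e sets_refs n) blast+
qed

lemma L_measurable_dists:
  assumes "P \<in> dists Z" "e \<in> units Z"
  shows "L_det Z e n \<in> borel_measurable P" "L_iso Z e n \<in> borel_measurable P"
proof -
  note sub = subalgebra_filt[OF sets_dists[OF assms(1)], of \<infinity>]
  show "L_det Z e n \<in> borel_measurable P" "L_iso Z e n \<in> borel_measurable P"
    by (rule measurable_from_subalg[OF sub L_measurable(1)[OF assms(2)]], simp)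
      (rule measurable_from_subalg[OF sub L_measurable(2)[OF assms(2)]], simp)
qed

lemma hypotheses_subset_dists: "H_0 Z \<subseteq> dists Z" "P_Psi Z \<subseteq> dists Z" "G_Psi Z e \<subseteq> dists Z" "H_Psi Z e \<subseteq> dists Z"
  by (auto simp: H_0_def P_Psi_def G_Psi_def H_Psi_def)

lemma subsystems_sources:
  assumes "e \<in> units Z"
  shows "sdet Z e \<subseteq> sources Z" "siso Z e \<subseteq> sources Z"
  using subsystems[OF assms] by auto

text \<open>
  The true law has the finite family \<open>Ps\<close> as competitors, and each of them accounts for \<open>1 / c\<close>. The
  set \<open>X\<close> stands for the event that a statistic is large or small.
\<close>

lemma family_crossing:
  fixes c :: real
  assumes P: "P \<in> dists Z" and s: "s \<subseteq> sources Z" and c: "0 < c"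
    and Ps: "Ps \<subseteq> law Z s ` dists Z" and r: "r \<in> law Z s ` dists Z" "r' \<in> law Z s ` dists Z"
    and ac: "\<And>n q u. 1 \<le> n \<Longrightarrow> q \<in> insert (law Z s P) Ps \<Longrightarrow> u \<in> {r, r'} \<Longrightarrow> mutually_ac Z s n q u"
    and X: "\<And>\<omega>. \<omega> \<in> X \<Longrightarrow> \<omega> \<in> space P \<and> (\<exists>n\<ge>1. \<exists>q\<in>Ps.
      c * lr Z s n (law Z s P) r (proj s \<omega>) \<le> lr Z s n q r (proj s \<omega>) \<or>
      c * lr Z s n (law Z s P) r' (proj s \<omega>) \<le> lr Z s n q r' (proj s \<omega>))"
  shows "measure P X \<le> card Ps / c"
proof -
  interpret P: prob_space P
    by (rule prob_dists[OF P])
  define Y where "Y q = {\<omega> \<in> space P. \<exists>n\<ge>1.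
    c * lr Z s n (law Z s P) r (proj s \<omega>) \<le> lr Z s n q r (proj s \<omega>) \<or>
    c * lr Z s n (law Z s P) r' (proj s \<omega>) \<le> lr Z s n q r' (proj s \<omega>)}" for q
  have fin: "finite Ps"
    using Ps finite_imageI[OF finite_dists] by (rule finite_subset)
  have Y: "Y q \<in> sets P" "measure P (Y q) \<le> 1 / c" if "q \<in> Ps" for q
    unfolding Y_def using that Ps r ac by (intro likelihood_ratio_crossing P s c; auto)+
  have "measure P X \<le> measure P (\<Union>q\<in>Ps. Y q)"
  proof (intro P.finite_measure_mono sets.finite_UN fin Y subsetI)
    show "\<omega> \<in> (\<Union>q\<in>Ps. Y q)" if "\<omega> \<in> X" for \<omega>
      using X[OF that] by (auto simp: Y_def)
  qed
  also have "\<dots> \<le> (\<Sum>q\<in>Ps. measure P (Y q))"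
    using Y fin by (intro P.finite_measure_subadditive_finite) auto
  also have "\<dots> \<le> (\<Sum>q\<in>Ps. 1 / c)"
    by (intro sum_mono Y)
  finally show ?thesis
    by simp
qed

lemma prob_L_det_large_le:
  assumes e: "e \<in> units Z" and P: "P \<in> H_0 Z" and c: "0 < c"
  shows "measure P {\<omega> \<in> space P. \<exists>n\<ge>1. ennreal c \<le> L_det Z e n \<omega>} \<le> card_d Z e / c"
  unfolding card_d_def
proof (rule family_crossing[where s = "sdet Z e" and r = "refdet Z e" and r' = "refdet Z e"])
  let ?s = "sdet Z e" and ?r = "refdet Z e"
  show "\<omega> \<in> space P \<and> (\<exists>n\<ge>1. \<exists>q\<in>G_laws Z e ?s.
      c * lr Z ?s n (law Z ?s P) ?r (proj ?s \<omega>)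
        \<le> lr Z ?s n q ?r (proj ?s \<omega>) \<or>
      c * lr Z ?s n (law Z ?s P) ?r (proj ?s \<omega>)
        \<le> lr Z ?s n q ?r (proj ?s \<omega>))"
    if "\<omega> \<in> {\<omega> \<in> space P. \<exists>n\<ge>1. ennreal c \<le> L_det Z e n \<omega>}" for \<omega>
    using that c lr_max_ratio_ge[OF finite_laws(1)[OF e] G_det_nonempty[OF e] finite_laws(3)[OF e] law_in_H0_laws[OF e P]]
    unfolding L_det_def by blast
  show "mutually_ac Z ?s n q u"
    if "1 \<le> n" "q \<in> insert (law Z ?s P) (G_laws Z e ?s)" "u \<in> {?r, ?r}"
    for n q u
    using that e refs[OF e] subsystems[OF e] law_in_H0_laws[OF e P] by (intro ac[where e=e]) auto
  show "P \<in> dists Z"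
    using P hypotheses_subset_dists by blast
  show "?s \<subseteq> sources Z" "0 < c" "G_laws Z e ?s \<subseteq> law Z ?s ` dists Z"
    "?r \<in> law Z ?s ` dists Z"
    by (fact subsystems_sources[OF e] c laws_subset[OF e] ref_laws[OF e])+
  show "?r \<in> law Z ?s ` dists Z"
    by (fact ref_laws[OF e])
qed

lemma prob_L_det_small_le:
  assumes e: "e \<in> units Z" and P: "P \<in> G_Psi Z e" and c: "0 < c"
  shows "measure P {\<omega> \<in> space P. \<exists>n\<ge>1. L_det Z e n \<omega> \<le> ennreal (1 / c)} \<le> card_c Z e / c"
  unfolding card_c_def
proof (rule family_crossing[where s = "sdet Z e" and r = "refdet Z e" and r' = "refdet Z e"])
  let ?s = "sdet Z e" and ?r = "refdet Z e"
  have "H0_laws Z e ?s \<noteq> {}"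
    using refs[OF e] by auto
  note small = lr_max_ratio_le[OF finite_laws(1)[OF e] law_in_G_laws[OF P] finite_laws(3)[OF e] this]
  show "\<omega> \<in> space P \<and> (\<exists>n\<ge>1. \<exists>q\<in>H0_laws Z e ?s.
      c * lr Z ?s n (law Z ?s P) ?r (proj ?s \<omega>)
        \<le> lr Z ?s n q ?r (proj ?s \<omega>) \<or>
      c * lr Z ?s n (law Z ?s P) ?r (proj ?s \<omega>)
        \<le> lr Z ?s n q ?r (proj ?s \<omega>))"
    if "\<omega> \<in> {\<omega> \<in> space P. \<exists>n\<ge>1. L_det Z e n \<omega> \<le> ennreal (1 / c)}" for \<omega>
    using that c small unfolding L_det_def by blast
  show "mutually_ac Z ?s n q u"
    if "1 \<le> n" "q \<in> insert (law Z ?s P) (H0_laws Z e ?s)" "u \<in> {?r, ?r}"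
    for n q u
    using that e refs[OF e] subsystems[OF e] law_in_G_laws[OF P] by (intro ac[where e=e]) auto
  show "P \<in> dists Z"
    using P hypotheses_subset_dists by blast
  show "?s \<subseteq> sources Z" "0 < c" "H0_laws Z e ?s \<subseteq> law Z ?s ` dists Z"
    "?r \<in> law Z ?s ` dists Z"
    by (fact subsystems_sources[OF e] c laws_subset[OF e] ref_laws[OF e])+
  show "?r \<in> law Z ?s ` dists Z"
    by (fact ref_laws[OF e])
qed

lemma prob_L_iso_large_le:
  assumes e: "e \<in> units Z" and P: "P \<in> H_Psi Z e" and c: "0 < c"
  shows "measure P {\<omega> \<in> space P. \<exists>n\<ge>1. ennreal c \<le> L_iso Z e n \<omega>} \<le> card_b Z e / c"
  unfolding card_b_def
proof (rule family_crossing[where s = "siso Z e" and r = "refiso Z e" and r' = "refiso Z e"])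
  let ?s = "siso Z e" and ?r = "refiso Z e"
  show "\<omega> \<in> space P \<and> (\<exists>n\<ge>1. \<exists>q\<in>G_laws Z e ?s.
      c * lr Z ?s n (law Z ?s P) ?r (proj ?s \<omega>)
        \<le> lr Z ?s n q ?r (proj ?s \<omega>) \<or>
      c * lr Z ?s n (law Z ?s P) ?r (proj ?s \<omega>)
        \<le> lr Z ?s n q ?r (proj ?s \<omega>))"
    if "\<omega> \<in> {\<omega> \<in> space P. \<exists>n\<ge>1. ennreal c \<le> L_iso Z e n \<omega>}" for \<omega>
    using that c lr_max_ratio_ge[OF finite_laws(1)[OF e] G_iso_nonempty[OF e] finite_laws(2)[OF e] law_in_H_laws[OF e P]]
    unfolding L_iso_def by blast
  show "mutually_ac Z ?s n q u"
    if n: "1 \<le> n" and q: "q \<in> insert (law Z ?s P) (G_laws Z e ?s)"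
      and u: "u \<in> {?r, ?r}" for n q u
  proof (cases "q = law Z ?s P")
    case True
    show ?thesis
      by (rule mutually_ac_sym)
        (use n u True e refs[OF e] subsystems[OF e] law_in_H_laws[OF e P] in \<open>auto intro: ac[where e=e]\<close>)
  next
    case False
    then show ?thesis
      using n q u e refs[OF e] subsystems[OF e] by (intro ac[where e=e]) auto
  qed
  show "P \<in> dists Z"
    using P hypotheses_subset_dists by blast
  show "?s \<subseteq> sources Z" "0 < c" "G_laws Z e ?s \<subseteq> law Z ?s ` dists Z"
    "?r \<in> law Z ?s ` dists Z"
    by (fact subsystems_sources[OF e] c laws_subset[OF e] ref_laws[OF e])+
  show "?r \<in> law Z ?s ` dists Z"
    by (fact ref_laws[OF e])
qed

text \<open>
  For a local unit the detection statistic compares the same two families as the isolation statistic,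
  with another reference law. Its event is included in the bound at no extra cost, because
  one crossing bound covers both reference laws.
\<close>

lemma prob_L_iso_small_le:
  assumes e: "e \<in> units Z" and P: "P \<in> G_Psi Z e" and c: "0 < c"
  shows "measure P {\<omega> \<in> space P. \<exists>n\<ge>1. L_iso Z e n \<omega> \<le> ennreal (1 / c) \<or>
      local_unit Z e \<and> L_det Z e n \<omega> \<le> ennreal (1 / c)} \<le> card_a Z e / c"
  unfolding card_a_def
proof (rule family_crossing[where s = "siso Z e" and r = "refiso Z e"
      and r' = "if local_unit Z e then refdet Z e else refiso Z e"])
  let ?s = "siso Z e" and ?r = "refiso Z e"
  \<comment> \<open>Outside local units, the second reference law repeats the first.\<close>
  let ?r' = "if local_unit Z e then refdet Z e else refiso Z e"
  note small = lr_max_ratio_le[OF finite_laws(1)[OF e] law_in_G_laws[OF P] finite_laws(2)[OF e] H_iso_nonempty[OF e]]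
  have loc: "L_det Z e n \<omega> = lr_max Z ?s n (G_laws Z e ?s) (refdet Z e) \<omega> /
      lr_max Z ?s n (H_laws Z e ?s) (refdet Z e) \<omega>" if "local_unit Z e" for n \<omega>
    using that by (simp add: L_det_def H_laws_def H0_laws_def local_unit_def)
  have r': "?r' \<in> H0_laws Z e ?s"
    using refs[OF e] by (auto simp: local_unit_def)
  then show "?r' \<in> law Z ?s ` dists Z"
    using laws_subset[OF e] by blast
  show "\<omega> \<in> space P \<and> (\<exists>n\<ge>1. \<exists>q\<in>H_laws Z e ?s.
      c * lr Z ?s n (law Z ?s P) ?r (proj ?s \<omega>)
        \<le> lr Z ?s n q ?r (proj ?s \<omega>) \<or>
      c * lr Z ?s n (law Z ?s P) ?r' (proj ?s \<omega>)
        \<le> lr Z ?s n q ?r' (proj ?s \<omega>))"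
    if \<omega>: "\<omega> \<in> {\<omega> \<in> space P. \<exists>n\<ge>1. L_iso Z e n \<omega> \<le> ennreal (1 / c) \<or>
      local_unit Z e \<and> L_det Z e n \<omega> \<le> ennreal (1 / c)}" for \<omega>
  proof -
    from \<omega> obtain n where n: "\<omega> \<in> space P" "1 \<le> n"
      and "L_iso Z e n \<omega> \<le> ennreal (1 / c) \<or> local_unit Z e \<and> L_det Z e n \<omega> \<le> ennreal (1 / c)"
      by blast
    then consider "L_iso Z e n \<omega> \<le> ennreal (1 / c)" | "local_unit Z e" "L_det Z e n \<omega> \<le> ennreal (1 / c)"
      by blast
    then show ?thesis
    proof cases
      case 1
      then show ?thesis
        using n small[OF c] unfolding L_iso_def by blast
    next
      case 2
      then have "\<exists>q\<in>H_laws Z e ?s.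
          c * lr Z ?s n (law Z ?s P) ?r' (proj ?s \<omega>)
            \<le> lr Z ?s n q ?r' (proj ?s \<omega>)"
        using small[OF c] by (simp add: loc)
      then show ?thesis
        using n by blast
    qed
  qed
  show "mutually_ac Z ?s n q u"
    if n: "1 \<le> n" and q: "q \<in> insert (law Z ?s P) (H_laws Z e ?s)"
      and u: "u \<in> {?r, ?r'}" for n q u
  proof -
    have u: "u \<in> H0_laws Z e ?s"
      using u r' refs[OF e] by auto
    show ?thesis
    proof (cases "q = law Z ?s P")
      case True
      then show ?thesis
        using n u e subsystems[OF e] law_in_G_laws[OF P] by (intro ac[where e=e]) auto
    next
      case False
      show ?thesis
        by (rule mutually_ac_sym) (use n u q False e subsystems[OF e] in \<open>auto intro: ac[where e=e]\<close>)
    qed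
  qed
  show "P \<in> dists Z"
    using P hypotheses_subset_dists by blast
  show "?s \<subseteq> sources Z" "0 < c" "H_laws Z e ?s \<subseteq> law Z ?s ` dists Z"
    "?r \<in> law Z ?s ` dists Z"
    by (fact subsystems_sources[OF e] c laws_subset[OF e] ref_laws[OF e])+
qed

end


section \<open>Stopping times and decisions\<close>

text \<open>
  A finite infimum of times is attained, as \<open>enat\<close> is well-ordered.
\<close>

lemma first_time_attained:
  assumes "first_time \<phi> \<noteq> \<infinity>"
  obtains n where "1 \<le> n" "\<phi> n" "first_time \<phi> = enat n"
proof -
  have "{n. 1 \<le> n \<and> \<phi> n} \<noteq> {}"
  proof
    assume "{n. 1 \<le> n \<and> \<phi> n} = {}"
    then have "first_time \<phi> = \<infinity>"
      unfolding first_time_def by (simp only: image_empty Inf_empty top_enat_def)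
    with assms show False by simp
  qed
  then obtain k where "k \<in> {n. 1 \<le> n \<and> \<phi> n}"
    by blast
  then have "first_time \<phi> \<in> enat ` {n. 1 \<le> n \<and> \<phi> n}"
    unfolding first_time_def by (intro wellorder_InfI[of "enat k"] imageI)
  then show ?thesis
    using that by auto
qed

lemma first_time_le: "1 \<le> n \<Longrightarrow> \<phi> n \<Longrightarrow> first_time \<phi> \<le> enat n"
  unfolding first_time_def by (intro INF_lower) auto

lemma one_le_first_time: "1 \<le> first_time \<phi>"
  unfolding first_time_def one_enat_def by (intro INF_greatest) auto

lemma first_time_le_iff: "first_time \<phi> \<le> enat m \<longleftrightarrow> (\<exists>n\<in>{1..m}. \<phi> n)"
proof
  assume le: "first_time \<phi> \<le> enat m"
  then have "first_time \<phi> \<noteq> \<infinity>" by (cases "first_time \<phi>") auto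
  then show "\<exists>n\<in>{1..m}. \<phi> n"
    using le by (elim first_time_attained) auto
next
  assume "\<exists>n\<in>{1..m}. \<phi> n"
  then show "first_time \<phi> \<le> enat m"
    by (auto intro: order_trans[OF first_time_le])
qed

lemma pred_filt_mono:
  assumes "Measurable.pred (filt Z s u) \<phi>" "u \<le> t"
  shows "Measurable.pred (filt Z s t) \<phi>"
  using assms sets_filt_mono[OF assms(2), of Z s] by (auto simp: pred_def)

lemma stopping_time_first_time:
  assumes "\<And>n. Measurable.pred (filt Z s (enat n)) (\<lambda>\<omega>. \<phi> n \<omega>)"
  shows "stopping_time (filt Z s) (\<lambda>\<omega>. first_time (\<lambda>n. \<phi> n \<omega>))"
proof
  fix t :: enat
  show "Measurable.pred (filt Z s t) (\<lambda>\<omega>. first_time (\<lambda>n. \<phi> n \<omega>) \<le> t)"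
  proof (cases t)
    case (enat m)
    have "Measurable.pred (filt Z s t) (\<phi> n)" if "n \<in> {1..m}" for n
      using that enat by (intro pred_filt_mono[OF assms]) simp
    then have "Measurable.pred (filt Z s t) (\<lambda>\<omega>. \<exists>n\<in>{1..m}. \<phi> n \<omega>)"
      by (intro pred_intros_finite) auto
    then show ?thesis
      by (simp only: enat first_time_le_iff)
  qed simp
qed

text \<open>
  On the event that \<open>S\<close> comes first, the minimum equals \<open>S\<close>.
\<close>

lemma (in filtration) less_in_pre_sigma_min:
  assumes S: "stopping_time F S" and T: "stopping_time F T"
  shows "{\<omega> \<in> \<Omega>. S \<omega> < T \<omega>} \<in> sets (pre_sigma (\<lambda>\<omega>. min (S \<omega>) (T \<omega>)))"
proof (rule sets_pre_sigmaI[OF stopping_time_min[OF S T]])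
  fix t
  have "{\<omega> \<in> \<Omega>. S \<omega> < T \<omega>} \<in> sets (pre_sigma S)"
    using stopping_time_less[OF S T] by (simp add: pred_def space_pre_sigma)
  from sets_pre_sigmaD[OF S this, of t]
  have "{\<omega> \<in> {\<omega> \<in> \<Omega>. S \<omega> < T \<omega>}. S \<omega> \<le> t} \<in> sets (F t)" .
  also have "{\<omega> \<in> {\<omega> \<in> \<Omega>. S \<omega> < T \<omega>}. S \<omega> \<le> t} = {\<omega> \<in> {\<omega> \<in> \<Omega>. S \<omega> < T \<omega>}. min (S \<omega>) (T \<omega>) \<le> t}"
    by (auto simp: min_def)
  finally show "{\<omega> \<in> {\<omega> \<in> \<Omega>. S \<omega> < T \<omega>}. min (S \<omega>) (T \<omega>) \<le> t} \<in> sets (F t)" .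
qed

lemma pred_le_const:
  fixes f :: "'a \<Rightarrow> ennreal"
  assumes "f \<in> borel_measurable M"
  shows "Measurable.pred M (\<lambda>x. f x \<le> c)" "Measurable.pred M (\<lambda>x. c \<le> f x)"
    "Measurable.pred M (\<lambda>x. f x < c)" "Measurable.pred M (\<lambda>x. c < f x)"
  using borel_measurable_le[OF assms borel_measurable_const[of c]]
    borel_measurable_le[OF borel_measurable_const[of c] assms]
    borel_measurable_less[OF assms borel_measurable_const[of c]]
    borel_measurable_less[OF borel_measurable_const[of c] assms]
  by (simp_all only: pred_def)

context joint_problem
begin

lemma finite_Psi: "finite (Psi Z)"
  using Psi by (rule finite_subset) (simp add: finite_units)

lemmas L_measurable_at = L_measurable[OF _ order_refl]

lemma pred_D_iso:
  "Measurable.pred (filt Z (sources Z) n) (\<lambda>\<omega>. D_iso Z n \<omega> = S)"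
proof (cases "S \<subseteq> units Z")
  case True
  have "Measurable.pred (filt Z (sources Z) n) (\<lambda>\<omega>. 1 < L_iso Z e n \<omega> \<longleftrightarrow> e \<in> S)"
    if "e \<in> units Z" for e
    using pred_le_const(4)[OF L_measurable_at(2)[OF that]] by (cases "e \<in> S") auto
  then have "Measurable.pred (filt Z (sources Z) n) (\<lambda>\<omega>. \<forall>e\<in>units Z. 1 < L_iso Z e n \<omega> \<longleftrightarrow> e \<in> S)"
    by (intro pred_intros_finite finite_units)
  also have "(\<lambda>\<omega>. \<forall>e\<in>units Z. 1 < L_iso Z e n \<omega> \<longleftrightarrow> e \<in> S) = (\<lambda>\<omega>. D_iso Z n \<omega> = S)"
    using True by (auto simp: D_iso_def fun_eq_iff)
  finally show ?thesis .
next
  case False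
  then have "(\<lambda>\<omega>. D_iso Z n \<omega> = S) = (\<lambda>\<omega>. False)"
    by (auto simp: D_iso_def fun_eq_iff)
  then show ?thesis by simp
qed

lemma stopping_time_T_0: "stopping_time (filt Z (sources Z)) (T_0 Z C)"
  unfolding T_0_def[abs_def]
  by (intro stopping_time_first_time pred_intros_finite finite_units pred_le_const L_measurable_at)

lemma stopping_time_T_det: "stopping_time (filt Z (sources Z)) (T_det Z D)"
  unfolding T_det_def[abs_def]
  by (intro stopping_time_first_time pred_intros_finite finite_units pred_le_const L_measurable_at)

lemma stopping_time_T_joint: "stopping_time (filt Z (sources Z)) (T_joint Z A B D)"
proof -
  have "Measurable.pred (filt Z (sources Z) (enat n)) (\<lambda>\<omega>. \<exists>S\<in>Psi Z - {{}}. D_iso Z n \<omega> = S)" for n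
    by (intro pred_intros_finite pred_D_iso) (simp add: finite_Psi)
  then have *: "Measurable.pred (filt Z (sources Z) (enat n)) (\<lambda>\<omega>. D_iso Z n \<omega> \<in> Psi Z - {{}})" for n
    by simp
  show ?thesis
    unfolding T_joint_def[abs_def] greaterThanLessThan_iff
    by (intro stopping_time_first_time pred_intros_logic(2-3) pred_intros_finite finite_units
        pred_le_const L_measurable_at *)
qed

lemma chi_det_in_tests:
  assumes "{} \<in> Psi Z" and \<psi>: "\<psi> \<in> F_at Z (T_star_det Z C D) \<rightarrow>\<^sub>M count_space (Psi Z - {{}})"
  shows "chi_det Z C D \<psi> \<in> tests Z"
proof -
  interpret F: filtration "space (path_space Z (sources Z))" "filt Z (sources Z)"
    by (rule filtration_filt)
  have T: "T_star_det Z C D = (\<lambda>\<omega>. min (T_0 Z C \<omega>) (T_det Z D \<omega>))"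
    by (simp add: T_star_det_def fun_eq_iff)
  have "(\<lambda>\<omega>. if T_0 Z C \<omega> < T_det Z D \<omega> then {} else \<psi> \<omega>) \<in>
      F_at Z (T_star_det Z C D) \<rightarrow>\<^sub>M count_space (Psi Z)"
  proof (rule measurable_If)
    show "(\<lambda>\<omega>. {}) \<in> F_at Z (T_star_det Z C D) \<rightarrow>\<^sub>M count_space (Psi Z)"
      using assms(1) by (intro measurable_const) simp
    show "\<psi> \<in> F_at Z (T_star_det Z C D) \<rightarrow>\<^sub>M count_space (Psi Z)"
      using measurable_compose[OF \<psi>, of "\<lambda>x. x" "count_space (Psi Z)"] by simp
    show "{\<omega> \<in> space (F_at Z (T_star_det Z C D)). T_0 Z C \<omega> < T_det Z D \<omega>} \<in> sets (F_at Z (T_star_det Z C D))"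
      using F.less_in_pre_sigma_min[OF stopping_time_T_0 stopping_time_T_det]
      by (simp add: F_at_def F.space_pre_sigma T)
  qed
  then show ?thesis
    using stopping_time_min[OF stopping_time_T_0 stopping_time_T_det]
    by (simp add: tests_def chi_det_def T)
      (simp add: T_0_def T_det_def one_le_first_time)
qed

text \<open>
  The decision takes finitely many values, so it is enough to place each event \<open>{D = S}\<close> in the
  sigma-algebra of the stopping time. On the rejection event the joint stopping time is a finite \<open>n\<close>
  and the decision is \<open>D_iso Z n\<close>, which is known at time \<open>n\<close>; on its complement the decision is
  empty.
\<close>

lemma chi_star_in_tests:
  assumes "{} \<in> Psi Z"
  shows "chi_star Z A B C D \<in> tests Z"
proof -
  interpret F: filtration "space (path_space Z (sources Z))" "filt Z (sources Z)"
    by (rule filtration_filt)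
  let ?\<Omega> = "space (path_space Z (sources Z))"
  let ?S = "T_0 Z C" and ?J = "T_joint Z A B D"
  let ?T = "\<lambda>\<omega>. min (?S \<omega>) (?J \<omega>)"
  let ?D = "\<lambda>\<omega>. if ?J \<omega> < ?S \<omega> then D_iso Z (the_enat (?J \<omega>)) \<omega> else {}"
  note st = stopping_time_T_0[of C] stopping_time_T_joint[of A B D]
  note stT = stopping_time_min[OF st]
  have reject: "{\<omega> \<in> ?\<Omega>. ?J \<omega> < ?S \<omega>} \<in> sets (F_at Z ?T)"
    using F.less_in_pre_sigma_min[OF st(2,1)] by (simp add: F_at_def min.commute)
  have at: "{\<omega> \<in> ?\<Omega>. ?J \<omega> = enat n \<and> enat n < ?S \<omega> \<and> D_iso Z n \<omega> = S} \<in> sets (F_at Z ?T)" (is "?R \<in> _")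
    for n S
    unfolding F_at_def
  proof (rule F.sets_pre_sigmaI[OF stT])
    fix t
    have "Measurable.pred (filt Z (sources Z) n) (\<lambda>\<omega>. ?J \<omega> = enat n \<and> enat n < ?S \<omega> \<and> D_iso Z n \<omega> = S)"
      by (intro pred_intros_logic(3) F.stopping_time_eq_const stopping_timeD2 st pred_D_iso)
    then have R: "?R \<in> sets (filt Z (sources Z) n)"
      by (simp add: pred_def)
    show "{\<omega> \<in> ?R. ?T \<omega> \<le> t} \<in> sets (filt Z (sources Z) t)"
    proof (cases "enat n \<le> t")
      case True
      then have eq: "{\<omega> \<in> ?R. ?T \<omega> \<le> t} = ?R"
        by (auto simp: min_def)
      show ?thesis
        unfolding eq using sets_filt_mono[OF True] R by (rule subsetD)
    next
      case False
      then have eq: "{\<omega> \<in> ?R. ?T \<omega> \<le> t} = {}"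
        by (auto simp: min_def)
      show ?thesis
        unfolding eq by (rule sets.empty_sets)
    qed
  qed
  have "?D \<in> F_at Z ?T \<rightarrow>\<^sub>M count_space (Psi Z)"
    unfolding measurable_count_space_eq2[OF finite_Psi]
  proof (intro conjI ballI)
    show "?D \<in> space (F_at Z ?T) \<rightarrow> Psi Z"
    proof
      fix \<omega>
      show "?D \<omega> \<in> Psi Z"
      proof (cases "?J \<omega> < ?S \<omega>")
        case True
        then have "?J \<omega> \<noteq> \<infinity>" by (cases "?J \<omega>") auto
        then obtain n where "?J \<omega> = enat n" "D_iso Z n \<omega> \<in> Psi Z - {{}}"
          unfolding T_joint_def by (elim first_time_attained) auto
        then show ?thesis
          by (simp add: assms)
      qed (simp add: assms)
    qed
  next
    fix S
    have space: "space (F_at Z ?T) = ?\<Omega>"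
      by (simp add: F_at_def F.space_pre_sigma)
    have "?D -` {S} \<inter> space (F_at Z ?T) =
        (\<Union>n. {\<omega> \<in> ?\<Omega>. ?J \<omega> = enat n \<and> enat n < ?S \<omega> \<and> D_iso Z n \<omega> = S}) \<union>
        (if S = {} then ?\<Omega> - {\<omega> \<in> ?\<Omega>. ?J \<omega> < ?S \<omega>} else {})" (is "?L = ?U \<union> ?V")
    proof (intro set_eqI)
      fix \<omega>
      show "\<omega> \<in> ?L \<longleftrightarrow> \<omega> \<in> ?U \<union> ?V"
        by (cases "?J \<omega>") (auto simp: space)
    qed
    also have "\<dots> \<in> sets (F_at Z ?T)"
      using at reject sets.top[of "F_at Z ?T"] by (intro sets.Un sets.countable_UN) (auto simp: space)
    finally show "?D -` {S} \<inter> space (F_at Z ?T) \<in> sets (F_at Z ?T)" .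
  qed
  then show ?thesis
    using stT by (simp add: tests_def chi_star_def)
      (simp add: T_0_def T_joint_def one_le_first_time)
qed

end


section \<open>Error probabilities\<close>

text \<open>
  Error events are only ever included in measurable events about the statistics; this is how the
  bounds for the latter reach the error probabilities.
\<close>

lemma measure_decided_le:
  assumes "prob_space P" "E \<in> sets P" "measure P E \<le> x"
    and "\<And>\<omega>. \<omega> \<in> space P \<Longrightarrow> fst \<xi> \<omega> < \<infinity> \<Longrightarrow> \<phi> (snd \<xi> \<omega>) \<Longrightarrow> \<omega> \<in> E"
  shows "decides P \<xi> \<phi> \<le> x"
proof -
  interpret prob_space P by fact
  have "decides P \<xi> \<phi> \<le> measure P E"
    unfolding decides_def using assms by (intro finite_measure_mono) auto
  with assms show ?thesis by simp
qed

lemma event_exists_time: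
  assumes "\<And>n. {\<omega> \<in> space P. Q n \<omega>} \<in> sets P"
  shows "{\<omega> \<in> space P. \<exists>n\<ge>(1::nat). Q n \<omega>} \<in> sets P"
proof -
  have "{\<omega> \<in> space P. \<exists>n\<ge>1. Q n \<omega>} = (\<Union>n\<in>{1..}. {\<omega> \<in> space P. Q n \<omega>})"
    by auto
  then show ?thesis
    using assms by (simp add: sets.countable_UN)
qed

text \<open>
  The joint rule stops only with a nonempty selection, so an empty decision upon stopping can come from
  \<open>T_0\<close> alone; this covers a tie of the two stopping times.
\<close>

lemma chi_star_accepts:
  assumes "fst (chi_star Z A B C D) \<omega> < \<infinity>" "snd (chi_star Z A B C D) \<omega> = {}"
  shows "\<exists>n\<ge>1. \<forall>e\<in>units Z. L_det Z e n \<omega> \<le> ennreal (1 / C e)"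
proof -
  have "\<not> T_joint Z A B D \<omega> < T_0 Z C \<omega>"
  proof
    assume lt: "T_joint Z A B D \<omega> < T_0 Z C \<omega>"
    then have "T_joint Z A B D \<omega> \<noteq> \<infinity>"
      by (cases "T_joint Z A B D \<omega>") auto
    then obtain n where "T_joint Z A B D \<omega> = enat n" "D_iso Z n \<omega> \<noteq> {}"
      unfolding T_joint_def by (elim first_time_attained) auto
    then show False
      using assms(2) lt by (simp add: chi_star_def)
  qed
  then have "T_0 Z C \<omega> \<noteq> \<infinity>"
    using assms(1) by (auto simp: chi_star_def min_def split: if_splits)
  then show ?thesis
    unfolding T_0_def by (elim first_time_attained) auto
qed

lemma chi_star_rejects:
  assumes "snd (chi_star Z A B C D) \<omega> \<noteq> {}"
  obtains n where "1 \<le> n" "\<exists>e\<in>units Z. ennreal (D e) \<le> L_det Z e n \<omega>"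
    "\<forall>e\<in>units Z. L_iso Z e n \<omega> \<notin> {ennreal (1 / A e) <..< ennreal (B e)}"
    "snd (chi_star Z A B C D) \<omega> = D_iso Z n \<omega>"
proof -
  have lt: "T_joint Z A B D \<omega> < T_0 Z C \<omega>"
    using assms by (auto simp: chi_star_def split: if_splits)
  then have "T_joint Z A B D \<omega> \<noteq> \<infinity>"
      by (cases "T_joint Z A B D \<omega>") auto
  then obtain n where "1 \<le> n" "T_joint Z A B D \<omega> = enat n" "\<exists>e\<in>units Z. ennreal (D e) \<le> L_det Z e n \<omega>"
    "\<forall>e\<in>units Z. L_iso Z e n \<omega> \<notin> {ennreal (1 / A e) <..< ennreal (B e)}"
    unfolding T_joint_def by (elim first_time_attained) auto
  with lt show ?thesis
    by (intro that[of n]) (auto simp: chi_star_def)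
qed

context joint_problem
begin

lemma active_null: "P \<in> H_0 Z \<Longrightarrow> active Z P = {}"
  using nulls_alts by (auto simp: H_0_def active_def)

text \<open>
  Outside the global null some unit is not null, and laws in \<open>P_Psi\<close> are null or alternative at each unit.
\<close>

lemma active_nonempty:
  assumes "P \<in> P_Psi Z - H_0 Z"
  obtains e where "e \<in> active Z P"
  using assms by (auto simp: P_Psi_def H_0_def active_def)

lemma active_subset: "active Z P \<subseteq> units Z"
  by (auto simp: active_def)

lemma one_le_cards:
  assumes "e \<in> units Z"
  shows "1 \<le> card_a Z e" "1 \<le> card_b Z e" "1 \<le> card_c Z e" "1 \<le> card_d Z e"
  using finite_laws[OF assms] refs[OF assms]
    G_det_nonempty[OF assms] G_iso_nonempty[OF assms] H_iso_nonempty[OF assms]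
  by (auto simp: card_a_def card_b_def card_c_def card_d_def Suc_le_eq card_gt_0_iff)

lemma one_le_card_units: "e \<in> units Z \<Longrightarrow> 1 \<le> real (card (units Z))"
  using finite_units by (auto simp: Suc_le_eq card_gt_0_iff)

lemma threshold_gt_1:
  fixes m x c :: real
  assumes "e \<in> units Z" "1 \<le> m" "0 < x" "x < 1" "m * card (units Z) / x \<le> c"
  shows "1 < c"
proof -
  have "1 * 1 \<le> m * card (units Z)"
    using assms one_le_card_units[OF assms(1)] by (intro mult_mono) auto
  then have "x < m * card (units Z)"
    using assms by simp
  then have "1 < m * card (units Z) / x"
    using assms by simp
  with assms(5) show ?thesis by linarith
qed

text \<open>
  The level \<open>x\<close> is divided equally among all \<open>|K|\<close> units: the threshold gives each unit in \<open>I\<close> the share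
  \<open>x / |K|\<close>. If there are no units, the event is empty and \<open>x / 0 = 0\<close> is harmless.
\<close>

lemma units_union_bound:
  assumes P: "P \<in> dists Z" and I: "I \<subseteq> units Z" and x: "0 < x"
    and X: "\<And>e n. e \<in> I \<Longrightarrow> {\<omega> \<in> space P. Q e n \<omega>} \<in> sets P"
    and le: "\<And>e. e \<in> I \<Longrightarrow> 0 < c e \<Longrightarrow> measure P {\<omega> \<in> space P. \<exists>n\<ge>(1::nat). Q e n \<omega>} \<le> m e / c e"
    and m: "\<And>e. e \<in> I \<Longrightarrow> 1 \<le> m e" and c: "\<And>e. e \<in> I \<Longrightarrow> m e * card (units Z) / x \<le> c e"
  shows "measure P {\<omega> \<in> space P. \<exists>n\<ge>1. \<exists>e\<in>I. Q e n \<omega>} \<le> x" (is "measure P ?E \<le> x")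
    and "{\<omega> \<in> space P. \<exists>n\<ge>1. \<exists>e\<in>I. Q e n \<omega>} \<in> sets P"
proof -
  let ?X = "\<lambda>e. {\<omega> \<in> space P. \<exists>n\<ge>1. Q e n \<omega>}"
  interpret prob_space P
    by (rule prob_dists[OF P])
  have finI: "finite I"
    using I finite_units by (rule finite_subset)
  have X: "?X e \<in> sets P" if "e \<in> I" for e
    using X[OF that] by (rule event_exists_time)
  have E: "?E = (\<Union>e\<in>I. ?X e)"
    by auto
  show "?E \<in> sets P"
    unfolding E using X finI by (intro sets.finite_UN)
  have "measure P (?X e) \<le> x / card (units Z)" if e: "e \<in> I" for e
  proof -
    have K: "1 \<le> real (card (units Z))"
      using one_le_card_units I e by blast
    have "0 < m e * card (units Z) / x"
      using m[OF e] K x by (intro divide_pos_pos mult_pos_pos) auto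
    then have pos: "0 < c e"
      using c[OF e] by linarith
    have "measure P (?X e) \<le> m e / c e"
      using le[OF e pos] .
    also have "m e / c e \<le> x / card (units Z)"
      using c[OF e] pos K x by (simp add: field_simps)
    finally show ?thesis .
  qed
  then have "(\<Sum>e\<in>I. measure P (?X e)) \<le> (\<Sum>e\<in>I. x / card (units Z))"
    by (rule sum_mono)
  moreover have "measure P ?E \<le> (\<Sum>e\<in>I. measure P (?X e))"
    unfolding E by (intro finite_measure_subadditive_finite finI image_subsetI X)
  moreover have "card I * (x / card (units Z)) \<le> x"
  proof -
    have "real (card I) \<le> card (units Z)"
      using card_mono[OF finite_units I] by simp
    then have "card I * x \<le> card (units Z) * x"
      using x by (intro mult_right_mono) auto
    then show ?thesis
      using x by (cases "card (units Z) = 0") (auto simp: field_simps)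
  qed
  ultimately show "measure P ?E \<le> x"
    by simp
qed

lemma prob_false_alarm:
  assumes P: "P \<in> H_0 Z" and x: "0 < x" and D: "\<And>e. e \<in> units Z \<Longrightarrow> card_d Z e * card (units Z) / x \<le> D e"
  shows "measure P {\<omega> \<in> space P. \<exists>n\<ge>1. \<exists>e\<in>units Z. ennreal (D e) \<le> L_det Z e n \<omega>} \<le> x" (is ?p)
    and "{\<omega> \<in> space P. \<exists>n\<ge>1. \<exists>e\<in>units Z. ennreal (D e) \<le> L_det Z e n \<omega>} \<in> sets P" (is ?s)
proof -
  have dP: "P \<in> dists Z"
    using P hypotheses_subset_dists by blast
  have "{\<omega> \<in> space P. ennreal (D e) \<le> L_det Z e n \<omega>} \<in> sets P" if "e \<in> units Z" for e n
    using pred_le_const(2)[OF L_measurable_dists(1)[OF dP that]] by (simp add: pred_def)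
  note union = units_union_bound[OF dP order_refl x this prob_L_det_large_le[OF _ P] one_le_cards(4) D]
  show ?p by (rule union(1))
  show ?s by (rule union(2))
qed

lemma prob_false_isolation:
  assumes P: "P \<in> P_Psi Z - H_0 Z" and x: "0 < x"
    and B: "\<And>e. e \<in> units Z \<Longrightarrow> card_b Z e * card (units Z) / x \<le> B e"
  shows "measure P {\<omega> \<in> space P. \<exists>n\<ge>1. \<exists>e\<in>units Z - active Z P. ennreal (B e) \<le> L_iso Z e n \<omega>} \<le> x" (is ?p)
    and "{\<omega> \<in> space P. \<exists>n\<ge>1. \<exists>e\<in>units Z - active Z P. ennreal (B e) \<le> L_iso Z e n \<omega>} \<in> sets P" (is ?s)
proof -
  have dP: "P \<in> dists Z"
    using P hypotheses_subset_dists by blast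
  have X: "{\<omega> \<in> space P. ennreal (B e) \<le> L_iso Z e n \<omega>} \<in> sets P" if "e \<in> units Z - active Z P" for e n
    using that pred_le_const(2)[OF L_measurable_dists(2)[OF dP]] by (simp add: pred_def)
  have le: "measure P {\<omega> \<in> space P. \<exists>n\<ge>1. ennreal (B e) \<le> L_iso Z e n \<omega>} \<le> card_b Z e / B e"
    if "e \<in> units Z - active Z P" "0 < B e" for e
    using that P by (intro prob_L_iso_large_le) (auto simp: H_Psi_def)
  note union = units_union_bound[OF dP Diff_subset x X le one_le_cards(2) B]
  show ?p by (rule union(1)) auto
  show ?s by (rule union(2)) auto
qed

text \<open>
  The disjunct for local units is what lets the same event cover missed detections in the local case.
\<close>

lemma prob_missed_isolation:
  assumes P: "P \<in> P_Psi Z" and x: "0 < x"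
    and A: "\<And>e. e \<in> units Z \<Longrightarrow> card_a Z e * card (units Z) / x \<le> A e"
  shows "measure P {\<omega> \<in> space P. \<exists>n\<ge>1. \<exists>e\<in>active Z P. L_iso Z e n \<omega> \<le> ennreal (1 / A e) \<or>
      local_unit Z e \<and> L_det Z e n \<omega> \<le> ennreal (1 / A e)} \<le> x" (is ?p)
    and "{\<omega> \<in> space P. \<exists>n\<ge>1. \<exists>e\<in>active Z P. L_iso Z e n \<omega> \<le> ennreal (1 / A e) \<or>
      local_unit Z e \<and> L_det Z e n \<omega> \<le> ennreal (1 / A e)} \<in> sets P" (is ?s)
proof -
  have dP: "P \<in> dists Z"
    using P hypotheses_subset_dists by blast
  have X: "{\<omega> \<in> space P. L_iso Z e n \<omega> \<le> ennreal (1 / A e) \<or>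
      local_unit Z e \<and> L_det Z e n \<omega> \<le> ennreal (1 / A e)} \<in> sets P" if "e \<in> active Z P" for e n
  proof -
    have e: "e \<in> units Z"
      using that active_subset by blast
    have "Measurable.pred P (\<lambda>\<omega>. L_iso Z e n \<omega> \<le> ennreal (1 / A e) \<or>
        local_unit Z e \<and> L_det Z e n \<omega> \<le> ennreal (1 / A e))"
      by (intro pred_intros_logic pred_le_const L_measurable_dists dP e) simp
    then show ?thesis by (simp add: pred_def)
  qed
  have le: "measure P {\<omega> \<in> space P. \<exists>n\<ge>1. L_iso Z e n \<omega> \<le> ennreal (1 / A e) \<or>
      local_unit Z e \<and> L_det Z e n \<omega> \<le> ennreal (1 / A e)} \<le> card_a Z e / A e"
    if "e \<in> active Z P" "0 < A e" for e
    using that P active_subset by (intro prob_L_iso_small_le) (auto simp: G_Psi_def)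
  note union = units_union_bound[OF dP active_subset x X le one_le_cards(1) A]
  show ?p by (rule union(1)) (use active_subset in auto)
  show ?s by (rule union(2)) (use active_subset in auto)
qed

text \<open>
  Acceptance requires all detection statistics to be small at the same time, so a single active unit
  suffices for the bound and no factor \<open>|K|\<close> appears.
\<close>

lemma prob_missed_detection:
  assumes P: "P \<in> P_Psi Z - H_0 Z" and x: "0 < x" and C: "\<And>e. e \<in> units Z \<Longrightarrow> card_c Z e / x \<le> C e"
  shows "measure P {\<omega> \<in> space P. \<exists>n\<ge>1. \<forall>e\<in>units Z. L_det Z e n \<omega> \<le> ennreal (1 / C e)} \<le> x"
    and "{\<omega> \<in> space P. \<exists>n\<ge>1. \<forall>e\<in>units Z. L_det Z e n \<omega> \<le> ennreal (1 / C e)} \<in> sets P"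
proof -
  have dP: "P \<in> dists Z"
    using P hypotheses_subset_dists by blast
  interpret prob_space P
    by (rule prob_dists[OF dP])
  obtain e where act: "e \<in> active Z P"
    using active_nonempty[OF P] .
  then have e: "e \<in> units Z"
    using active_subset by blast
  have "0 < card_c Z e / x"
    using one_le_cards(3)[OF e] x by simp
  then have pos: "0 < C e"
    using C[OF e] by linarith
  let ?X = "{\<omega> \<in> space P. \<exists>n\<ge>1. L_det Z e n \<omega> \<le> ennreal (1 / C e)}"
  have "?X \<in> sets P"
    using pred_le_const(1)[OF L_measurable_dists(1)[OF dP e]]
    by (intro event_exists_time) (simp add: pred_def)
  then have "measure P {\<omega> \<in> space P. \<exists>n\<ge>1. \<forall>e\<in>units Z. L_det Z e n \<omega> \<le> ennreal (1 / C e)} \<le> measure P ?X"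
    using e by (intro finite_measure_mono subsetI) blast
  also have "\<dots> \<le> card_c Z e / C e"
    using P act pos by (intro prob_L_det_small_le e) (auto simp: G_Psi_def)
  also have "\<dots> \<le> x"
    using C[OF e] pos x by (simp add: field_simps)
  finally show "measure P {\<omega> \<in> space P. \<exists>n\<ge>1. \<forall>e\<in>units Z. L_det Z e n \<omega> \<le> ennreal (1 / C e)} \<le> x" .
  have "Measurable.pred P (\<lambda>\<omega>. \<forall>e\<in>units Z. L_det Z e n \<omega> \<le> ennreal (1 / C e))" for n
    by (intro pred_intros_finite finite_units pred_le_const L_measurable_dists dP)
  then show "{\<omega> \<in> space P. \<exists>n\<ge>1. \<forall>e\<in>units Z. L_det Z e n \<omega> \<le> ennreal (1 / C e)} \<in> sets P"
    by (intro event_exists_time) (simp add: pred_def)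
qed

lemma chi_star_false_alarm:
  assumes P: "P \<in> H_0 Z" and x: "0 < x" and D: "\<And>e. e \<in> units Z \<Longrightarrow> card_d Z e * card (units Z) / x \<le> D e"
  shows "decides P (chi_star Z A B C D) (\<lambda>S. S \<noteq> {}) \<le> x"
proof (rule measure_decided_le[OF _ prob_false_alarm(2,1)[OF P x D]])
  show "prob_space P"
    using P by (intro prob_dists) (simp add: H_0_def)
  fix \<omega> assume "\<omega> \<in> space P" "snd (chi_star Z A B C D) \<omega> \<noteq> {}"
  then show "\<omega> \<in> {\<omega> \<in> space P. \<exists>n\<ge>1. \<exists>e\<in>units Z. ennreal (D e) \<le> L_det Z e n \<omega>}"
    by (elim chi_star_rejects) auto
qed

lemma chi_star_missed_detection:
  assumes P: "P \<in> P_Psi Z - H_0 Z" and x: "0 < x" and C: "\<And>e. e \<in> units Z \<Longrightarrow> card_c Z e / x \<le> C e"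
  shows "decides P (chi_star Z A B C D) (\<lambda>S. S = {}) \<le> x"
proof (rule measure_decided_le[OF _ prob_missed_detection(2,1)[OF P x C]])
  show "prob_space P"
    using P by (intro prob_dists) (simp add: P_Psi_def)
  show "\<omega> \<in> {\<omega> \<in> space P. \<exists>n\<ge>1. \<forall>e\<in>units Z. L_det Z e n \<omega> \<le> ennreal (1 / C e)}"
    if "\<omega> \<in> space P" "fst (chi_star Z A B C D) \<omega> < \<infinity>" "snd (chi_star Z A B C D) \<omega> = {}" for \<omega>
    using that chi_star_accepts[OF that(2,3)] by blast
qed

text \<open>
  A selected unit has an isolation statistic above \<open>1 > 1 / A\<^sub>e\<close>; as the statistic lies outside the
  interval \<open>(1 / A\<^sub>e, B\<^sub>e)\<close>, it has passed \<open>B\<^sub>e\<close>.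
\<close>

lemma chi_star_false_isolation:
  assumes P: "P \<in> P_Psi Z - H_0 Z" and x: "0 < x" and A: "\<And>e. e \<in> units Z \<Longrightarrow> 1 < A e"
    and B: "\<And>e. e \<in> units Z \<Longrightarrow> card_b Z e * card (units Z) / x \<le> B e"
  shows "decides P (chi_star Z A B C D) (\<lambda>S. S - active Z P \<noteq> {}) \<le> x"
proof (rule measure_decided_le[OF _ prob_false_isolation(2,1)[OF P x B]])
  show "prob_space P"
    using P by (intro prob_dists) (simp add: P_Psi_def)
  fix \<omega> assume \<omega>: "\<omega> \<in> space P" and S: "snd (chi_star Z A B C D) \<omega> - active Z P \<noteq> {}"
  then have "snd (chi_star Z A B C D) \<omega> \<noteq> {}" by blast
  then obtain n where n: "1 \<le> n" "snd (chi_star Z A B C D) \<omega> = D_iso Z n \<omega>"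
    and iso: "\<forall>e\<in>units Z. L_iso Z e n \<omega> \<notin> {ennreal (1 / A e) <..< ennreal (B e)}"
    by (elim chi_star_rejects) auto
  then obtain e where e: "e \<in> units Z" "e \<notin> active Z P" "1 < L_iso Z e n \<omega>"
    using S by (auto simp: D_iso_def)
  have "ennreal (1 / A e) \<le> 1"
    using A[OF e(1)] by (simp flip: ennreal_1 add: ennreal_leI)
  then have "ennreal (1 / A e) < L_iso Z e n \<omega>"
    using e(3) by (rule order_le_less_trans)
  then have "ennreal (B e) \<le> L_iso Z e n \<omega>"
    using bspec[OF iso e(1)] unfolding greaterThanLessThan_iff by (meson not_le)
  then show "\<omega> \<in> {\<omega> \<in> space P. \<exists>n\<ge>1. \<exists>e\<in>units Z - active Z P. ennreal (B e) \<le> L_iso Z e n \<omega>}"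
    using \<omega> n e by blast
qed

text \<open>
  An omitted unit has an isolation statistic of at most \<open>1 < B\<^sub>e\<close>; as the statistic lies outside the
  interval \<open>(1 / A\<^sub>e, B\<^sub>e)\<close>, it is at most \<open>1 / A\<^sub>e\<close>.
\<close>

lemma chi_star_missed_unit:
  assumes S: "snd (chi_star Z A B C D) \<omega> \<noteq> {}" "active Z P - snd (chi_star Z A B C D) \<omega> \<noteq> {}"
    and B: "\<And>e. e \<in> units Z \<Longrightarrow> 1 < B e"
  shows "\<exists>n\<ge>1. \<exists>e\<in>active Z P. L_iso Z e n \<omega> \<le> ennreal (1 / A e)"
proof -
  obtain n where n: "1 \<le> n" "snd (chi_star Z A B C D) \<omega> = D_iso Z n \<omega>"
    and iso: "\<forall>e\<in>units Z. L_iso Z e n \<omega> \<notin> {ennreal (1 / A e) <..< ennreal (B e)}"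
    using chi_star_rejects[OF S(1)] by metis
  obtain e where act: "e \<in> active Z P" "e \<notin> D_iso Z n \<omega>"
    using S(2) n(2) by auto
  then have e: "e \<in> units Z" "e \<in> active Z P" "L_iso Z e n \<omega> \<le> 1"
    using active_subset[of P] by (auto simp: D_iso_def)
  have "1 < ennreal (B e)"
    using B[OF e(1)] by (simp flip: ennreal_1 add: ennreal_lessI)
  then have "L_iso Z e n \<omega> < ennreal (B e)"
    using e(3) by (rule order_le_less_trans[rotated])
  then have "L_iso Z e n \<omega> \<le> ennreal (1 / A e)"
    using bspec[OF iso e(1)] unfolding greaterThanLessThan_iff by (meson not_le)
  then show ?thesis
    using n e by blast
qed

lemma chi_star_missed_isolation:
  assumes P: "P \<in> P_Psi Z" and x: "0 < x" and B: "\<And>e. e \<in> units Z \<Longrightarrow> 1 < B e"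
    and A: "\<And>e. e \<in> units Z \<Longrightarrow> card_a Z e * card (units Z) / x \<le> A e"
  shows "decides P (chi_star Z A B C D) (\<lambda>S. active Z P - S \<noteq> {} \<and> S \<noteq> {}) \<le> x"
proof (rule measure_decided_le[OF _ prob_missed_isolation(2,1)[OF P x A]])
  show "prob_space P"
    using P by (intro prob_dists) (simp add: P_Psi_def)
  show "\<omega> \<in> {\<omega> \<in> space P. \<exists>n\<ge>1. \<exists>e\<in>active Z P. L_iso Z e n \<omega> \<le> ennreal (1 / A e) \<or>
      local_unit Z e \<and> L_det Z e n \<omega> \<le> ennreal (1 / A e)}"
    if "\<omega> \<in> space P" "active Z P - snd (chi_star Z A B C D) \<omega> \<noteq> {} \<and> snd (chi_star Z A B C D) \<omega> \<noteq> {}" for \<omega>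
  proof -
    have "\<exists>n\<ge>1. \<exists>e\<in>active Z P. L_iso Z e n \<omega> \<le> ennreal (1 / A e)"
      using that(2) by (intro chi_star_missed_unit[where B = B] B) auto
    then show ?thesis
      using that(1) by blast
  qed
qed

text \<open>
  With local units and \<open>C = A\<close>, accepting the null makes the detection statistic of an active unit at
  most \<open>1 / A\<^sub>e\<close>. This is part of the event of \<open>prob_missed_isolation\<close>, so missing everything and
  missing some unit are bounded together.
\<close>

lemma chi_star_missed_local:
  assumes P: "P \<in> P_Psi Z - H_0 Z" and x: "0 < x" and B: "\<And>e. e \<in> units Z \<Longrightarrow> 1 < B e"
    and A: "\<And>e. e \<in> units Z \<Longrightarrow> card_a Z e * card (units Z) / x \<le> A e"
    and local: "\<And>e. e \<in> units Z \<Longrightarrow> local_unit Z e"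
  shows "decides P (chi_star Z A B A D) (\<lambda>S. active Z P - S \<noteq> {}) \<le> x"
proof (rule measure_decided_le[OF _ prob_missed_isolation(2,1)[OF DiffD1[OF P] x A]])
  show "prob_space P"
    using P by (intro prob_dists) (simp add: P_Psi_def)
  let ?E = "{\<omega> \<in> space P. \<exists>n\<ge>1. \<exists>e\<in>active Z P. L_iso Z e n \<omega> \<le> ennreal (1 / A e) \<or>
      local_unit Z e \<and> L_det Z e n \<omega> \<le> ennreal (1 / A e)}"
  fix \<omega> assume \<omega>: "\<omega> \<in> space P" "fst (chi_star Z A B A D) \<omega> < \<infinity>" "active Z P - snd (chi_star Z A B A D) \<omega> \<noteq> {}"
  show "\<omega> \<in> ?E"
  proof (cases "snd (chi_star Z A B A D) \<omega> = {}")
    case True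
    obtain e where "e \<in> active Z P"
      using active_nonempty[OF P] .
    then show ?thesis
      using \<omega> chi_star_accepts[OF \<omega>(2) True] active_subset[of P] local by blast
  next
    case False
    then show ?thesis
      using \<omega> chi_star_missed_unit[OF False \<omega>(3) B] by blast
  qed
qed

text \<open>
  An active unit is missed either because the null is accepted, which has probability at most \<open>y\<close>, or
  because the unit is left out of a nonempty selection, which has probability at most \<open>x\<close>.
\<close>

lemma chi_star_missed:
  assumes P: "P \<in> P_Psi Z - H_0 Z" and xy: "0 < x" "0 < y" and B: "\<And>e. e \<in> units Z \<Longrightarrow> 1 < B e"
    and A: "\<And>e. e \<in> units Z \<Longrightarrow> card_a Z e * card (units Z) / x \<le> A e"
    and C: "\<And>e. e \<in> units Z \<Longrightarrow> card_c Z e / y \<le> C e"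
  shows "decides P (chi_star Z A B C D) (\<lambda>S. active Z P - S \<noteq> {}) \<le> x + y"
proof -
  let ?X = "{\<omega> \<in> space P. \<exists>n\<ge>1. \<exists>e\<in>active Z P. L_iso Z e n \<omega> \<le> ennreal (1 / A e) \<or>
      local_unit Z e \<and> L_det Z e n \<omega> \<le> ennreal (1 / A e)}"
  let ?Y = "{\<omega> \<in> space P. \<exists>n\<ge>1. \<forall>e\<in>units Z. L_det Z e n \<omega> \<le> ennreal (1 / C e)}"
  have PP: "P \<in> P_Psi Z" and prob: "prob_space P"
    using P by (auto simp: P_Psi_def intro: prob_dists)
  interpret prob_space P by fact
  note X = prob_missed_isolation[OF PP xy(1) A]
  note Y = prob_missed_detection[OF P xy(2) C]
  show ?thesis
  proof (rule measure_decided_le[OF prob])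
    show "?X \<union> ?Y \<in> sets P"
      by (intro sets.Un X(2) Y(2))
    have "measure P (?X \<union> ?Y) \<le> measure P ?X + measure P ?Y"
      by (intro measure_Un_le X(2) Y(2))
    also have "\<dots> \<le> x + y"
      by (intro add_mono X(1) Y(1))
    finally show "measure P (?X \<union> ?Y) \<le> x + y" .
  next
    fix \<omega> assume \<omega>: "\<omega> \<in> space P" "fst (chi_star Z A B C D) \<omega> < \<infinity>" "active Z P - snd (chi_star Z A B C D) \<omega> \<noteq> {}"
    show "\<omega> \<in> ?X \<union> ?Y"
    proof (cases "snd (chi_star Z A B C D) \<omega> = {}")
      case True
      then show ?thesis
        using \<omega>(1) chi_star_accepts[OF \<omega>(2) True] by blast
    next
      case False
      then show ?thesis
        using \<omega>(1) chi_star_missed_unit[OF False \<omega>(3) B] by blast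
    qed
  qed
qed

lemma chi_det_in_detection_class:
  assumes Psi0: "{} \<in> Psi Z" and \<alpha>\<beta>: "0 < \<alpha>" "0 < \<beta>"
    and C: "\<And>e. e \<in> units Z \<Longrightarrow> card_c Z e / \<beta> \<le> C e"
    and D: "\<And>e. e \<in> units Z \<Longrightarrow> card_d Z e * card (units Z) / \<alpha> \<le> D e"
    and \<psi>: "\<psi> \<in> F_at Z (T_star_det Z C D) \<rightarrow>\<^sub>M count_space (Psi Z - {{}})"
  shows "chi_det Z C D \<psi> \<in> detection_class Z \<alpha> \<beta>"
proof -
  have \<psi>_nonempty: "\<psi> \<omega> \<noteq> {}" if "\<omega> \<in> space P" "P \<in> dists Z" for \<omega> P
  proof -
    have "space (F_at Z (T_star_det Z C D)) = space P"
      using filtration.space_pre_sigma[OF filtration_filt] space_dists[OF that(2)] by (simp add: F_at_def)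
    then show ?thesis
      using measurable_space[OF \<psi>] that by auto
  qed
  have "decides P (chi_det Z C D \<psi>) (\<lambda>S. S \<noteq> {}) \<le> \<alpha>" if P: "P \<in> H_0 Z" for P
  proof (rule measure_decided_le[OF _ prob_false_alarm(2,1)[OF P \<alpha>\<beta>(1) D]])
    show "prob_space P"
      using P by (intro prob_dists) (simp add: H_0_def)
    fix \<omega> assume \<omega>: "\<omega> \<in> space P" "fst (chi_det Z C D \<psi>) \<omega> < \<infinity>" "snd (chi_det Z C D \<psi>) \<omega> \<noteq> {}"
    then have "T_det Z D \<omega> \<noteq> \<infinity>"
      by (auto simp: chi_det_def T_star_det_def min_def split: if_splits)
    then show "\<omega> \<in> {\<omega> \<in> space P. \<exists>n\<ge>1. \<exists>e\<in>units Z. ennreal (D e) \<le> L_det Z e n \<omega>}"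
      using \<omega>(1) unfolding T_det_def by (elim first_time_attained) auto
  qed
  moreover have "decides P (chi_det Z C D \<psi>) (\<lambda>S. S = {}) \<le> \<beta>" if P: "P \<in> P_Psi Z - H_0 Z" for P
  proof (rule measure_decided_le[OF _ prob_missed_detection(2,1)[OF P \<alpha>\<beta>(2) C]])
    show "prob_space P"
      using P by (intro prob_dists) (simp add: P_Psi_def)
    fix \<omega> assume \<omega>: "\<omega> \<in> space P" "fst (chi_det Z C D \<psi>) \<omega> < \<infinity>" "snd (chi_det Z C D \<psi>) \<omega> = {}"
    have "\<psi> \<omega> \<noteq> {}"
      using \<omega>(1) P by (intro \<psi>_nonempty) (auto simp: P_Psi_def)
    then have "T_0 Z C \<omega> \<noteq> \<infinity>"
      using \<omega> by (auto simp: chi_det_def split: if_splits)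
    then show "\<omega> \<in> {\<omega> \<in> space P. \<exists>n\<ge>1. \<forall>e\<in>units Z. L_det Z e n \<omega> \<le> ennreal (1 / C e)}"
      using \<omega>(1) unfolding T_0_def by (elim first_time_attained) auto
  qed
  ultimately show ?thesis
    using chi_det_in_tests[OF Psi0 \<psi>] by (simp add: detection_class_def)
qed

lemma chi_star_in_joint_class:
  assumes Psi0: "{} \<in> Psi Z" and lev: "0 < \<alpha>" "0 < \<beta>" "0 < \<gamma>" "\<gamma> < 1" "0 < \<delta>" "\<delta> < 1"
    and C: "\<And>e. e \<in> units Z \<Longrightarrow> card_c Z e / \<beta> \<le> C e"
    and D: "\<And>e. e \<in> units Z \<Longrightarrow> card_d Z e * card (units Z) / \<alpha> \<le> D e"
    and A: "\<And>e. e \<in> units Z \<Longrightarrow> card_a Z e * card (units Z) / \<delta> \<le> A e"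
    and B: "\<And>e. e \<in> units Z \<Longrightarrow> card_b Z e * card (units Z) / \<gamma> \<le> B e"
  shows "chi_star Z A B C D \<in> joint_class Z \<alpha> \<beta> \<gamma> \<delta>"
proof -
  have A1: "1 < A e" and B1: "1 < B e" if "e \<in> units Z" for e
    using threshold_gt_1[OF that one_le_cards(1)[OF that] lev(5,6) A[OF that]]
      threshold_gt_1[OF that one_le_cards(2)[OF that] lev(3,4) B[OF that]] by auto
  show ?thesis
    unfolding joint_class_def detection_class_def
    using chi_star_in_tests[OF Psi0] chi_star_false_alarm[OF _ lev(1) D] chi_star_missed_detection[OF _ lev(2) C]
      chi_star_false_isolation[OF _ lev(3) A1 B] chi_star_missed_isolation[OF _ lev(5) B1 A]
    by auto
qed

text \<open>
  Under the global null, a false positive is a false alarm and is governed by the detection thresholds;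
  outside it, a false positive is a false isolation and is governed by the isolation thresholds. For \<open>\<chi>\<^sub>f\<^sub>w\<^sub>e\<^sub>r\<^sup>*\<close> both
  upper thresholds are \<open>B\<close>, hence two conditions on \<open>B\<close>.
\<close>

lemma chi_fwer_in_fwer_classI:
  assumes Psi0: "{} \<in> Psi Z" and \<gamma>: "0 < \<gamma>" and \<delta>: "0 \<le> \<delta>"
    and A: "\<And>e. e \<in> units Z \<Longrightarrow> 1 < A e"
    and Bb: "\<And>e. e \<in> units Z \<Longrightarrow> card_b Z e * card (units Z) / \<gamma> \<le> B e"
    and Bd: "\<And>e. e \<in> units Z \<Longrightarrow> card_d Z e * card (units Z) / \<gamma> \<le> B e"
    and miss: "\<And>P. P \<in> P_Psi Z - H_0 Z \<Longrightarrow> decides P (chi_fwer Z A B) (\<lambda>S. active Z P - S \<noteq> {}) \<le> \<delta>"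
  shows "chi_fwer Z A B \<in> fwer_class Z \<gamma> \<delta>"
proof -
  have "decides P (chi_fwer Z A B) (\<lambda>S. S - active Z P \<noteq> {}) \<le> \<gamma> \<and>
      decides P (chi_fwer Z A B) (\<lambda>S. active Z P - S \<noteq> {}) \<le> \<delta>" if P: "P \<in> P_Psi Z" for P
  proof (cases "P \<in> H_0 Z")
    case True
    then show ?thesis
      using chi_star_false_alarm[OF True \<gamma> Bd] \<delta>
      by (simp add: active_null chi_fwer_def) (simp add: decides_def)
  next
    case False
    then show ?thesis
      using P miss chi_star_false_isolation[OF _ \<gamma> A Bb] by (simp add: chi_fwer_def)
  qed
  then show ?thesis
    using chi_star_in_tests[OF Psi0] by (simp add: fwer_class_def chi_fwer_def)
qed

lemma chi_fwer_in_fwer_class: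
  assumes Psi0: "{} \<in> Psi Z" and lev: "0 < \<gamma>" "\<gamma> < 1" "0 < \<delta>" "\<delta> < 1"
    and A: "\<And>e. e \<in> units Z \<Longrightarrow> max (card_a Z e) (card_c Z e) * (card (units Z) + 1) / \<delta> \<le> A e"
    and B: "\<And>e. e \<in> units Z \<Longrightarrow> max (card_b Z e) (card_d Z e) * card (units Z) / \<gamma> \<le> B e"
  shows "chi_fwer Z A B \<in> fwer_class Z \<gamma> \<delta>"
proof (cases "units Z = {}")
  case True
  then show ?thesis
    using lev by (intro chi_fwer_in_fwer_classI Psi0) (auto simp: H_0_def P_Psi_def)
next
  case False
  let ?K = "real (card (units Z))"
  \<comment> \<open>The level is split into \<open>|K| + 1\<close> equal shares: one for the missed detection, one for each unit.\<close>
  define x y where "x = \<delta> * ?K / (?K + 1)" and "y = \<delta> / (?K + 1)"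
  have K: "1 \<le> ?K"
    using False one_le_card_units by blast
  have x: "0 < x" and y: "0 < y" and xy: "x + y = \<delta>"
  proof -
    have "x + y = \<delta> * (?K + 1) / (?K + 1)"
      by (simp add: x_def y_def add_divide_distrib distrib_left)
    then show "x + y = \<delta>"
      using K by simp
  qed (use K lev in \<open>simp_all add: x_def y_def\<close>)
  have Aa: "card_a Z e * ?K / x \<le> A e" and Ac: "card_c Z e / y \<le> A e" if e: "e \<in> units Z" for e
  proof -
    have "card_a Z e * ?K / x = card_a Z e * (?K + 1) / \<delta>"
      using K lev by (simp add: x_def field_simps)
    also have "\<dots> \<le> max (card_a Z e) (card_c Z e) * (?K + 1) / \<delta>"
      using lev by (intro divide_right_mono mult_right_mono) auto
    finally show "card_a Z e * ?K / x \<le> A e"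
      using A[OF e] by (simp add: add_ac)
    have "card_c Z e / y = card_c Z e * (?K + 1) / \<delta>"
      using K lev by (simp add: y_def field_simps)
    also have "\<dots> \<le> max (card_a Z e) (card_c Z e) * (?K + 1) / \<delta>"
      using lev by (intro divide_right_mono mult_right_mono) auto
    finally show "card_c Z e / y \<le> A e"
      using A[OF e] by (simp add: add_ac)
  qed
  have Bb: "card_b Z e * ?K / \<gamma> \<le> B e" and Bd: "card_d Z e * ?K / \<gamma> \<le> B e" if e: "e \<in> units Z" for e
  proof -
    have "card_b Z e * ?K / \<gamma> \<le> max (card_b Z e) (card_d Z e) * ?K / \<gamma>"
      "card_d Z e * ?K / \<gamma> \<le> max (card_b Z e) (card_d Z e) * ?K / \<gamma>"
      using lev by (auto intro!: divide_right_mono mult_right_mono)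
    then show "card_b Z e * ?K / \<gamma> \<le> B e" "card_d Z e * ?K / \<gamma> \<le> B e"
      using B[OF e] by auto
  qed
  have x1: "x < 1"
    using xy y lev by linarith
  have A1: "1 < A e" and B1: "1 < B e" if "e \<in> units Z" for e
    using threshold_gt_1[OF that one_le_cards(1)[OF that] x x1 Aa[OF that]]
      threshold_gt_1[OF that one_le_cards(2)[OF that] lev(1,2) Bb[OF that]] by auto
  show ?thesis
  proof (intro chi_fwer_in_fwer_classI Psi0 lev A1 Bb Bd)
    show "decides P (chi_fwer Z A B) (\<lambda>S. active Z P - S \<noteq> {}) \<le> \<delta>" if "P \<in> P_Psi Z - H_0 Z" for P
      using chi_star_missed[OF that x y B1 Aa Ac] by (simp add: chi_fwer_def xy)
  qed (use lev in auto)
qed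

lemma chi_fwer_in_fwer_class_local:
  assumes Psi0: "{} \<in> Psi Z" and lev: "0 < \<gamma>" "\<gamma> < 1" "0 < \<delta>" "\<delta> < 1"
    and local: "\<And>e. e \<in> units Z \<Longrightarrow> sdet Z e = e \<and> siso Z e = e"
    and A: "\<And>e. e \<in> units Z \<Longrightarrow> card_a Z e * card (units Z) / \<delta> \<le> A e"
    and B: "\<And>e. e \<in> units Z \<Longrightarrow> card_b Z e * card (units Z) / \<gamma> \<le> B e"
  shows "chi_fwer Z A B \<in> fwer_class Z \<gamma> \<delta>"
proof -
  have loc: "local_unit Z e" if "e \<in> units Z" for e
    using local[OF that] by (simp add: local_unit_def)
  have A1: "1 < A e" and B1: "1 < B e" if "e \<in> units Z" for e
    using threshold_gt_1[OF that one_le_cards(1)[OF that] lev(3,4) A[OF that]]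
      threshold_gt_1[OF that one_le_cards(2)[OF that] lev(1,2) B[OF that]] by auto
  have Bd: "card_d Z e * card (units Z) / \<gamma> \<le> B e" if "e \<in> units Z" for e
    using B[OF that] local[OF that] by (simp add: card_b_def card_d_def)
  show ?thesis
  proof (intro chi_fwer_in_fwer_classI Psi0 lev A1 B Bd)
    show "decides P (chi_fwer Z A B) (\<lambda>S. active Z P - S \<noteq> {}) \<le> \<delta>" if "P \<in> P_Psi Z - H_0 Z" for P
      using chi_star_missed_local[OF that lev(3) B1 A loc] by (simp add: chi_fwer_def)
  qed (use lev in auto)
qed

end

theorem theorem3p2:
  fixes Z :: "'v problem" and \<alpha> \<beta> \<gamma> \<delta> :: real
  assumes "joint_problem Z"
    and "{} \<in> Psi Z"
    and "\<alpha> \<in> {0<..<1}" "\<beta> \<in> {0<..<1}" "\<gamma> \<in> {0<..<1}" "\<delta> \<in> {0<..<1}"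
  shows
    "(\<forall>C D \<psi>.
        (\<forall>e\<in>units Z. C e \<ge> card_c Z e / \<beta> \<and> D e \<ge> card_d Z e * card (units Z) / \<alpha>) \<longrightarrow>
        \<psi> \<in> F_at Z (T_star_det Z C D) \<rightarrow>\<^sub>M count_space (Psi Z - {{}}) \<longrightarrow>
        chi_det Z C D \<psi> \<in> detection_class Z \<alpha> \<beta>) \<and>
     (\<forall>A B.
        (\<forall>e\<in>units Z. A e \<ge> max (card_a Z e) (card_c Z e) * (card (units Z) + 1) / \<delta> \<and>
                     B e \<ge> max (card_b Z e) (card_d Z e) * card (units Z) / \<gamma>) \<longrightarrow>
        chi_fwer Z A B \<in> fwer_class Z \<gamma> \<delta>) \<and>
     ((\<forall>e\<in>units Z. sdet Z e = e \<and> siso Z e = e) \<longrightarrow>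
      (\<forall>A B.
        (\<forall>e\<in>units Z. A e \<ge> card_a Z e * card (units Z) / \<delta> \<and>
                     B e \<ge> card_b Z e * card (units Z) / \<gamma>) \<longrightarrow>
        chi_fwer Z A B \<in> fwer_class Z \<gamma> \<delta>)) \<and>
     (\<forall>A B C D.
        (\<forall>e\<in>units Z. C e \<ge> card_c Z e / \<beta> \<and> D e \<ge> card_d Z e * card (units Z) / \<alpha> \<and>
                     A e \<ge> card_a Z e * card (units Z) / \<delta> \<and>
                     B e \<ge> card_b Z e * card (units Z) / \<gamma>) \<longrightarrow>
        chi_star Z A B C D \<in> joint_class Z \<alpha> \<beta> \<gamma> \<delta>)"
proof -
  interpret joint_problem Z by fact
  note lev = assms(3-6)[unfolded greaterThanLessThan_iff]
  show ?thesis
  proof (intro conjI allI impI)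
    fix C D \<psi>
    assume "\<forall>e\<in>units Z. C e \<ge> card_c Z e / \<beta> \<and> D e \<ge> card_d Z e * card (units Z) / \<alpha>"
      and "\<psi> \<in> F_at Z (T_star_det Z C D) \<rightarrow>\<^sub>M count_space (Psi Z - {{}})"
    then show "chi_det Z C D \<psi> \<in> detection_class Z \<alpha> \<beta>"
      using lev assms(2) by (intro chi_det_in_detection_class) auto
  next
    fix A B
    assume "\<forall>e\<in>units Z. A e \<ge> max (card_a Z e) (card_c Z e) * (card (units Z) + 1) / \<delta> \<and>
      B e \<ge> max (card_b Z e) (card_d Z e) * card (units Z) / \<gamma>"
    then show "chi_fwer Z A B \<in> fwer_class Z \<gamma> \<delta>"
      using lev by (intro chi_fwer_in_fwer_class assms(2)) blast+
  next
    fix A B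
    assume "\<forall>e\<in>units Z. sdet Z e = e \<and> siso Z e = e"
      and "\<forall>e\<in>units Z. A e \<ge> card_a Z e * card (units Z) / \<delta> \<and> B e \<ge> card_b Z e * card (units Z) / \<gamma>"
    then show "chi_fwer Z A B \<in> fwer_class Z \<gamma> \<delta>"
      using lev by (intro chi_fwer_in_fwer_class_local assms(2)) blast+
  next
    fix A B C D
    assume "\<forall>e\<in>units Z. C e \<ge> card_c Z e / \<beta> \<and> D e \<ge> card_d Z e * card (units Z) / \<alpha> \<and>
      A e \<ge> card_a Z e * card (units Z) / \<delta> \<and> B e \<ge> card_b Z e * card (units Z) / \<gamma>"
    then show "chi_star Z A B C D \<in> joint_class Z \<alpha> \<beta> \<gamma> \<delta>"
      using lev by (intro chi_star_in_joint_class assms(2)) blast+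
  qed
qed

end
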